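(* Let $V$ be a vector space over a field $\mathbb{K}$, $N\ge 1$, $a\in\mathbb{K}^N$, and let $F_1,\ldots,F_N$ be endomorphisms of $V$ making $V$ a module over the Lie algebra $\mathfrak{g}_a$ via $\epsilon_i.v=F_i(v)$. Let $x\in V$, $k\geq 1$, $f,g_1,\ldots,g_k\in T(V)^N$, $i\in\{1,\ldots,N\}$. Then, for the extension of $*$ to $S(\mathfrak{g}'_a)$ described in the context: $$\emptyset\epsilon_i*(g_1\blacktriangleleft\ldots\blacktriangleleft g_k)=0,$$ $$xf*(g_1\blacktriangleleft\ldots\blacktriangleleft g_k)=\sum_{\substack{I=\{i_1<\ldots<i_l\}\subseteq\{1,\ldots,k\},\\ j_1,\ldots,j_l\in\{1,\ldots,N\}}}F_{j_l}\circ\ldots\circ F_{j_1}(x)\left(\left(f*\prod_{i\notin I}^{\blacktriangleleft}g_i\right)sh_{j_1}\,g_{i_1}\ldots sh_{j_l}\,g_{i_l}\right);$$ $$\emptyset\epsilon_i*(g_1\ldots g_k)=0,$$ $$xf*(g_1\ldots g_k)=\sum_{\substack{I=\{i_1<\ldots<i_l\}\subseteq\{1,\ldots,k\},\\ j_1,\ldots,j_l\in\{1,\ldots,N\}}}F_{j_1,\ldots,j_l}(x)\left(\left(f*\prod_{i\notin I}g_i\right)sh_{j_1}\,g_{i_1}\ldots sh_{j_l}\,g_{i_l}\right).$$ Here $\prod^{\blacktriangleleft}_{i\notin I}g_i$ is the $\blacktriangleleft$-product of the $g_i$, $i\in\{1,\ldots,k\}\setminus I$, in increasing order of indices.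
   Context: $(\epsilon_1,\ldots,\epsilon_N)$ is the canonical basis of $\mathbb{K}^N$; $\mathfrak{g}_a=\mathbb{K}^N$ with Lie bracket $[\epsilon_i,\epsilon_j]_a=a_j\epsilon_i-a_i\epsilon_j$. $T(V)$ has empty word $\emptyset$ and shuffle product $sh$. Elements of $T(V)^N$ are written $f_1\epsilon_1+\ldots+f_N\epsilon_N$; left concatenation by $x\in V$ acts componentwise. For $f,g\in T(V)$, $x\in V$: $f\epsilon_i\,sh_j\,g\epsilon_l=\delta_{j,l}(f\,sh\,g)\epsilon_i$ (an iterated expression $u\,sh_{j_1}u_1\ldots sh_{j_l}u_l$ is bracketed from the left); $f\epsilon_i\;{}_a sh\;g\epsilon_j=a_i(f\,sh\,g)\epsilon_j$ (associative); ${}_a[f\epsilon_i,g\epsilon_j]=(f\,sh\,g)(a_i\epsilon_j-a_j\epsilon_i)$; and $*$ on $T(V)^N$ is defined inductively by $\emptyset\epsilon_i*g\epsilon_j=0$, $(xf)\epsilon_i*g\epsilon_j=x(f\epsilon_i*g\epsilon_j)+F_j(x)(f\,sh\,g)\epsilon_i$. Under the module hypothesis $\mathfrak{g}'_a=(T(V)^N,{}_a[-,-],* )$ is a (right) post-Lie algebra, i.e. $u*{}_a[v,w]=(u*v)*w-u*(v*w)-(u*w)*v+u*(w*v)$ and ${}_a[u,v]*w={}_a[u*w,v]+{}_a[u,v*w]$. For any associative algebra $(A,\triangleleft)$, the symmetric algebra $S(A)$, with usual coproduct $\Delta$ (elements of $A$ primitive) and counit $\varepsilon$, has an associative product $\blacktriangleleft$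 given by $$x_1\ldots x_k\blacktriangleleft y_1\ldots y_l=\sum_{I\subseteq\{1,\ldots,l\}}\ \sum_{\theta:I\hookrightarrow\{1,\ldots,k\}}\left(\prod_{i\notin \mathrm{Im}(\theta)}x_i\right)\left(\prod_{j\notin I}y_j\right)\left(\prod_{i\in I}x_{\theta(i)}\triangleleft y_i\right),$$ and $(S(A),\blacktriangleleft,\Delta)$ is isomorphic to the enveloping algebra of $A$ with its commutator bracket. Apply this to $(\mathfrak{g}'_a,\ \triangleleft={}_a sh)$: $(S(\mathfrak{g}'_a),\blacktriangleleft,\Delta)\cong\mathcal{U}(\mathfrak{g}'_a,{}_a[-,-])$. The product $*$ is extended (uniquely) to a bilinear product on $S(\mathfrak{g}'_a)$ such that for $F,G,H\in S(\mathfrak{g}'_a)$, $y\in\mathfrak{g}'_a$: $F*1=F$; $1*F=\varepsilon(F)1$; $F*(G\blacktriangleleft y)=(F*G)*y-F*(G*y)$; $(F\blacktriangleleft G)*H=\sum(F*H^{(1)})\blacktriangleleft(G*H^{(2)})$. Then $\mathfrak{g}'_a*S(\mathfrak{g}'_a)\subseteq\mathfrak{g}'_a$. Juxtaposition $g_1\ldots g_k$ is the commutative product of $S(\mathfrak{g}'_a)$. Apply it also to $\mathfrak{g}_a$ with $\epsilon_i\triangleleft\epsilon_j=a_j\epsilon_i$: the action gives an algebra morphism $\phi_V:\mathcal{U}(\mathfrak{g}_a)=(S(\mathfrak{g}_a),\blacktriangleleft)\to\mathrm{End}(V)$, $\epsilon_i\mapsto F_i$, and $F_{j_1,\ldots,j_l}:=\phi_V(\epsilon_{j_1}\ldots\epsilon_{j_l})$,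 the argument being the commutative monomial in $S(\mathfrak{g}_a)$ (for $l=0$ this is $\mathrm{Id}_V$). *)

theory Defs
  imports
    "HOL-Analysis.Finite_Cartesian_Product"
    "HOL-Library.FuncSet"
    "HOL-Library.Multiset"
    "HOL-Library.Poly_Mapping"
begin

section \<open>Vector spaces and algebras given by generators and relations\<close>

text \<open>A vector space over the field \<open>'k\<close> is a type together with a scalar multiplication
  satisfying the library locale \<^locale>\<open>vector_space\<close>.\<close>

definition bilinear_map ::
  "('k::field \<Rightarrow> 'a::ab_group_add \<Rightarrow> 'a) \<Rightarrow> ('k \<Rightarrow> 'b::ab_group_add \<Rightarrow> 'b) \<Rightarrow>
   ('k \<Rightarrow> 'c::ab_group_add \<Rightarrow> 'c) \<Rightarrow> ('a \<Rightarrow> 'b \<Rightarrow> 'c) \<Rightarrow> bool"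
  where "bilinear_map s1 s2 s3 m \<longleftrightarrow>
    (\<forall>u. Vector_Spaces.linear s2 s3 (\<lambda>v. m u v)) \<and>
    (\<forall>v. Vector_Spaces.linear s1 s3 (\<lambda>u. m u v))"

locale assoc_algebra = vector_space scale
  for scale :: "'k::field \<Rightarrow> 'b::ring_1 \<Rightarrow> 'b" +
  assumes scale_mult_left: "scale c (x * y) = scale c x * y"
    and scale_mult_right: "scale c (x * y) = x * scale c y"

text \<open>The free vector space on a set of words \<open>'w\<close> is \<open>'w \<Rightarrow>\<^sub>0 'k\<close>.\<close>

definition formal_scale :: "'k::field \<Rightarrow> ('w \<Rightarrow>\<^sub>0 'k) \<Rightarrow> ('w \<Rightarrow>\<^sub>0 'k)"
  where "formal_scale c p = Poly_Mapping.map (\<lambda>d. c * d) p"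

definition formal_eval ::
  "('k::field \<Rightarrow> 'b::ab_group_add \<Rightarrow> 'b) \<Rightarrow> ('w \<Rightarrow> 'b) \<Rightarrow> ('w \<Rightarrow>\<^sub>0 'k) \<Rightarrow> 'b"
  where "formal_eval s h p =
    (\<Sum>w\<in>Poly_Mapping.keys p. s (Poly_Mapping.lookup p w) (h w))"

lemma lookup_formal_scale: "Poly_Mapping.lookup (formal_scale c p) w = c * Poly_Mapping.lookup p w"
  by (simp add: formal_scale_def Poly_Mapping.map.rep_eq when_def)

lemma vector_space_formal_scale:
  "vector_space (formal_scale :: 'k::field \<Rightarrow> ('w \<Rightarrow>\<^sub>0 'k) \<Rightarrow> _)"
  by unfold_locales
    (auto intro!: poly_mapping_eqI simp: lookup_formal_scale lookup_add algebra_simps)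

lemma formal_eval_superset:
  assumes "vector_space s" "finite A" "Poly_Mapping.keys p \<subseteq> A"
  shows "formal_eval s h p = (\<Sum>w\<in>A. s (Poly_Mapping.lookup p w) (h w))"
proof -
  interpret vector_space s by fact
  show ?thesis unfolding formal_eval_def
    by (rule sum.mono_neutral_left) (use assms in \<open>auto simp: in_keys_iff\<close>)
qed

lemma linear_formal_eval:
  assumes "vector_space s"
  shows "Vector_Spaces.linear formal_scale s (formal_eval s h)"
proof -
  interpret vector_space s by fact
  interpret F: vector_space "formal_scale :: 'a \<Rightarrow> ('c \<Rightarrow>\<^sub>0 'a) \<Rightarrow> _"
    by (rule vector_space_formal_scale)
  show ?thesis
  proof unfold_locales
    fix p q :: "'c \<Rightarrow>\<^sub>0 'a" and c
    show "formal_eval s h (p + q) = formal_eval s h p + formal_eval s h q"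
      using keys_add[of p q]
      by (simp add: formal_eval_superset[OF assms, where A = "Poly_Mapping.keys p \<union> Poly_Mapping.keys q"]
        lookup_add scale_left_distrib sum.distrib)
    have "Poly_Mapping.keys (formal_scale c p) \<subseteq> Poly_Mapping.keys p"
      by (auto simp: in_keys_iff lookup_formal_scale)
    then show "formal_eval s h (formal_scale c p) = s c (formal_eval s h p)"
      by (simp add: formal_eval_superset[OF assms, where A = "Poly_Mapping.keys p"]
        lookup_formal_scale scale_sum_right)
  qed
qed

lemma formal_eval_single:
  assumes "vector_space s"
  shows "formal_eval s h (Poly_Mapping.single w c) = s c (h w)"
proof -
  interpret vector_space s by fact
  show ?thesis by (simp add: formal_eval_def)
qed

text \<open>The space \<open>'b\<close> is the quotient of the free vector space on \<open>'w\<close> by the span of \<open>rels\<close>,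
  \<open>word w\<close> being the class of \<open>w\<close>.\<close>

locale presented_space = vector_space scale
  for scale :: "'k::field \<Rightarrow> 'b::ab_group_add \<Rightarrow> 'b" +
  fixes word :: "'w \<Rightarrow> 'b" and rels :: "('w \<Rightarrow>\<^sub>0 'k) set"
  assumes eval_surj: "surj (formal_eval scale word)"
    and eval_kernel: "formal_eval scale word p = 0 \<longleftrightarrow> p \<in> module.span formal_scale rels"

context presented_space
begin

lemma span_words: "span (range word) = UNIV"
proof -
  have "y \<in> span (range word)" for y
  proof -
    obtain p where "y = formal_eval scale word p" using eval_surj by (metis surjD)
    then show ?thesis
      by (simp add: formal_eval_def span_sum span_scale span_base)
  qed
  then show ?thesis by auto
qed

lemma linear_extension:
  assumes W: "vector_space s" and h: "\<And>r. r \<in> rels \<Longrightarrow> formal_eval s h r = 0"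
  shows "\<exists>!L. Vector_Spaces.linear scale s L \<and> (\<forall>w. L (word w) = h w)"
proof -
  interpret E: Vector_Spaces.linear formal_scale scale "formal_eval scale word"
    by (rule linear_formal_eval) unfold_locales
  interpret H: Vector_Spaces.linear formal_scale s "formal_eval s h"
    by (rule linear_formal_eval) fact
  have *: "formal_eval s h p = formal_eval s h q"
    if "formal_eval scale word p = formal_eval scale word q" for p q
  proof -
    have "p - q \<in> E.vs1.span rels"
      using that eval_kernel[of "p - q"] by (simp add: E.diff)
    from H.eq_0_on_span[OF h this] show ?thesis by (simp add: H.diff)
  qed
  define L where "L y = formal_eval s h (SOME p. formal_eval scale word p = y)" for y
  have L: "L (formal_eval scale word p) = formal_eval s h p" for p
    unfolding L_def by (rule *) (rule someI[of _ p], simp)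
  have lin: "Vector_Spaces.linear scale s L"
  proof unfold_locales
    fix y z c
    obtain p q where [simp]: "y = formal_eval scale word p" "z = formal_eval scale word q"
      using eval_surj by (metis surjD)
    show "L (y + z) = L y + L z"
      using L[of "p + q"] by (simp add: L E.add H.add)
    show "L (scale c y) = s c (L y)"
      using L[of "formal_scale c p"] by (simp add: L E.scale H.scale)
  qed
  have word: "L (word w) = h w" for w
    using L[of "Poly_Mapping.single w 1"]
    by (simp add: formal_eval_single W vector_space_axioms vector_space.vector_space_assms(4)[OF W])
  show ?thesis
  proof (rule ex1I[of _ L])
    fix L' assume L': "Vector_Spaces.linear scale s L' \<and> (\<forall>w. L' (word w) = h w)"
    interpret P: vector_space_pair scale s using W by unfold_locales (simp_all add: vector_space.vector_space_assms)
    show "L' = L"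
    proof
      fix y show "L' y = L y"
        by (rule P.linear_eq_on_span[where B = "range word"]) (use L' lin word span_words in auto)
    qed
  qed (use lin word in auto)
qed

end

text \<open>\<open>T(V)\<close>: the space of words in elements of \<open>V\<close>, modulo multilinearity. The ring product is
  concatenation, so the empty word is \<open>1\<close> and left concatenation by \<open>x\<close> is multiplication by
  \<open>incl x\<close>. Since \<open>V\<close> has an arbitrary scalar multiplication, \<open>T(V)\<close> is not given by a single
  type constructor: the locale describes it up to isomorphism.\<close>

definition tensor_relations ::
  "('k::field \<Rightarrow> 'v::ab_group_add \<Rightarrow> 'v) \<Rightarrow> ('v list \<Rightarrow>\<^sub>0 'k) set"
  where "tensor_relations scaleV =
    {Poly_Mapping.single (u @ (x + y) # w) 1 - Poly_Mapping.single (u @ x # w) 1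
       - Poly_Mapping.single (u @ y # w) 1 | u w x y. True} \<union>
    {Poly_Mapping.single (u @ scaleV c x # w) 1 - Poly_Mapping.single (u @ x # w) c
       | u w c x. True}"

locale tensor_algebra =
  V: vector_space scaleV + assoc_algebra scaleT +
  presented_space scaleT "\<lambda>xs. prod_list (map incl xs)" "tensor_relations scaleV"
  for scaleV :: "'k::field \<Rightarrow> 'v::ab_group_add \<Rightarrow> 'v"
    and scaleT :: "'k \<Rightarrow> 't::ring_1 \<Rightarrow> 't"
    and incl :: "'v \<Rightarrow> 't"

context tensor_algebra
begin

lemma rel_eval:
  assumes W: "vector_space s"
    and "\<And>u w x y. h (u @ (x + y) # w) = h (u @ x # w) + h (u @ y # w)"
    and "\<And>u w c x. h (u @ scaleV c x # w) = s c (h (u @ x # w))"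
    and "r \<in> tensor_relations scaleV"
  shows "formal_eval s h r = 0"
proof -
  interpret H: Vector_Spaces.linear formal_scale s "formal_eval s h"
    by (rule linear_formal_eval) fact
  show ?thesis using assms(2-)
    by (auto simp: tensor_relations_def H.diff formal_eval_single W H.vs2.scale_one)
qed

lemma linear_incl: "Vector_Spaces.linear scaleV scaleT incl"
proof -
  let ?w = "\<lambda>xs. prod_list (map incl xs)"
  interpret E: Vector_Spaces.linear formal_scale scaleT "formal_eval scaleT ?w"
    by (rule linear_formal_eval) unfold_locales
  have 1: "formal_eval scaleT ?w r = 0" if "r \<in> tensor_relations scaleV" for r
    using eval_kernel[of r] that by (auto intro: E.vs1.span_base)
  note s = formal_eval_single[OF vector_space_axioms]
  show ?thesis
  proof unfold_locales
    fix x y c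
    have "Poly_Mapping.single [x + y] 1 - Poly_Mapping.single [x] 1 - Poly_Mapping.single [y] 1
      \<in> tensor_relations scaleV"
      unfolding tensor_relations_def by (intro UnI1 CollectI exI[of _ "[]"]) auto
    from 1[OF this] show "incl (x + y) = incl x + incl y" by (simp add: E.diff E.add s algebra_simps)
    have "Poly_Mapping.single [scaleV c x] 1 - Poly_Mapping.single [x] c
      \<in> tensor_relations scaleV"
      unfolding tensor_relations_def by (intro UnI2 CollectI exI[of _ "[]"]) auto
    from 1[OF this] show "incl (scaleV c x) = scaleT c (incl x)" by (simp add: E.diff s)
  qed
qed

lemma inj_incl: "inj incl"
proof
  fix x y assume xy: "incl x = incl y"
  define h where "h xs = (case xs of [z] \<Rightarrow> z | _ \<Rightarrow> 0)" for xs :: "'v list"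
  have "\<exists>!L. Vector_Spaces.linear scaleT scaleV L \<and> (\<forall>w. L (prod_list (map incl w)) = h w)"
  proof (rule linear_extension)
    fix r assume "r \<in> tensor_relations scaleV"
    then show "formal_eval scaleV h r = 0"
      by (rule rel_eval[rotated -1])
        (auto simp: h_def V.vector_space_axioms split: list.splits simp: append_eq_Cons_conv)
  qed unfold_locales
  then obtain L where L: "\<And>w. L (prod_list (map incl w)) = h w" by blast
  from L[of "[x]"] L[of "[y]"] xy show "x = y" by (simp add: h_def)
qed

text \<open>Universal property of the tensor algebra.\<close>

lemma universal:
  fixes scaleB :: "'k \<Rightarrow> 'd::ring_1 \<Rightarrow> 'd"
  assumes B: "assoc_algebra scaleB" and h: "Vector_Spaces.linear scaleV scaleB h"
  shows "\<exists>!L. Vector_Spaces.linear scaleT scaleB L \<and> L 1 = 1 \<and>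
    (\<forall>f g. L (f * g) = L f * L g) \<and> (\<forall>x. L (incl x) = h x)"
proof -
  interpret B: assoc_algebra scaleB by fact
  interpret h: Vector_Spaces.linear scaleV scaleB h by fact
  interpret P: vector_space_pair scaleT scaleB by unfold_locales
  let ?w = "\<lambda>xs. prod_list (map incl xs)" and ?h = "\<lambda>xs. prod_list (map h xs)"
  have E: "\<exists>!L. Vector_Spaces.linear scaleT scaleB L \<and> (\<forall>w. L (?w w) = ?h w)"
  proof (rule linear_extension)
    fix r assume "r \<in> tensor_relations scaleV"
    then show "formal_eval scaleB ?h r = 0"
      by (rule rel_eval[rotated -1])
        (auto simp: h.add h.scale distrib_left distrib_right B.vector_space_axioms
          B.scale_mult_left[symmetric] B.scale_mult_right[symmetric])
  qed unfold_locales
  then obtain L where L: "Vector_Spaces.linear scaleT scaleB L" "\<And>w. L (?w w) = ?h w" by blast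
  interpret L: Vector_Spaces.linear scaleT scaleB L by fact
  have span: "f \<in> span (range ?w)" for f using span_words by simp
  have mult: "L (f * g) = L f * L g" for f g
  proof -
    have 1: "L (?w u * g) = L (?w u) * L g" for u
    proof (rule P.linear_eq_on_span[where B = "range ?w", OF _ _ _ span])
      show "Vector_Spaces.linear scaleT scaleB (\<lambda>g. L (?w u * g))"
        by unfold_locales (simp_all add: distrib_left distrib_right L.add L.scale flip: scale_mult_right)
      show "Vector_Spaces.linear scaleT scaleB (\<lambda>g. L (?w u) * L g)"
        by unfold_locales (simp_all add: distrib_left distrib_right L.add L.scale flip: B.scale_mult_right)
      fix v assume "v \<in> range ?w"
      then obtain v' where "v = ?w v'" by auto
      then show "L (?w u * v) = L (?w u) * L v"
        using L(2)[of "u @ v'"] by (simp add: L(2))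
    qed
    show ?thesis
    proof (rule P.linear_eq_on_span[where f = "\<lambda>f. L (f * g)" and g = "\<lambda>f. L f * L g"
          and B = "range ?w", OF _ _ _ span])
      show "Vector_Spaces.linear scaleT scaleB (\<lambda>f. L (f * g))"
        by unfold_locales (simp_all add: distrib_left distrib_right L.add L.scale flip: scale_mult_left)
      show "Vector_Spaces.linear scaleT scaleB (\<lambda>f. L f * L g)"
        by unfold_locales (simp_all add: distrib_left distrib_right L.add L.scale flip: B.scale_mult_left)
    qed (auto simp: 1)
  qed
  show ?thesis
  proof (rule ex1I[of _ L])
    show "Vector_Spaces.linear scaleT scaleB L \<and> L 1 = 1 \<and>
      (\<forall>f g. L (f * g) = L f * L g) \<and> (\<forall>x. L (incl x) = h x)"
      using L(1) L(2)[of "[]"] L(2)[of "[_]"] mult by simp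
    fix M assume M: "Vector_Spaces.linear scaleT scaleB M \<and> M 1 = 1 \<and>
      (\<forall>f g. M (f * g) = M f * M g) \<and> (\<forall>x. M (incl x) = h x)"
    then have "M (?w w) = ?h w" for w by (induction w) auto
    then show "M = L" using E L M by blast
  qed
qed

end

text \<open>\<open>S(A)\<close>: the space of commutative words in elements of \<open>A\<close>, modulo multilinearity.\<close>

definition sym_relations ::
  "('k::field \<Rightarrow> 'a::ab_group_add \<Rightarrow> 'a) \<Rightarrow> ('a multiset \<Rightarrow>\<^sub>0 'k) set"
  where "sym_relations scaleA =
    {Poly_Mapping.single (add_mset (x + y) M) 1 - Poly_Mapping.single (add_mset x M) 1
       - Poly_Mapping.single (add_mset y M) 1 | M x y. True} \<union>
    {Poly_Mapping.single (add_mset (scaleA c x) M) 1 - Poly_Mapping.single (add_mset x M) c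
       | M c x. True}"

locale symmetric_algebra =
  A: vector_space scaleA + assoc_algebra scaleS +
  presented_space scaleS "\<lambda>M. prod_mset (image_mset incl M)" "sym_relations scaleA"
  for scaleA :: "'k::field \<Rightarrow> 'a::ab_group_add \<Rightarrow> 'a"
    and scaleS :: "'k \<Rightarrow> 's::comm_ring_1 \<Rightarrow> 's"
    and incl :: "'a \<Rightarrow> 's"

context symmetric_algebra
begin

lemma rel_eval:
  assumes W: "vector_space s"
    and "\<And>M x y. h (add_mset (x + y) M) = h (add_mset x M) + h (add_mset y M)"
    and "\<And>M c x. h (add_mset (scaleA c x) M) = s c (h (add_mset x M))"
    and "r \<in> sym_relations scaleA"
  shows "formal_eval s h r = 0"
proof -
  interpret H: Vector_Spaces.linear formal_scale s "formal_eval s h"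
    by (rule linear_formal_eval) fact
  show ?thesis using assms(2-)
    by (auto simp: sym_relations_def H.diff formal_eval_single W H.vs2.scale_one)
qed

lemma linear_incl: "Vector_Spaces.linear scaleA scaleS incl"
proof -
  let ?w = "\<lambda>M. prod_mset (image_mset incl M)"
  interpret E: Vector_Spaces.linear formal_scale scaleS "formal_eval scaleS ?w"
    by (rule linear_formal_eval) unfold_locales
  have 1: "formal_eval scaleS ?w r = 0" if "r \<in> sym_relations scaleA" for r
    using eval_kernel[of r] that by (auto intro: E.vs1.span_base)
  note s = formal_eval_single[OF vector_space_axioms]
  show ?thesis
  proof unfold_locales
    fix x y c
    have "Poly_Mapping.single {#x + y#} 1 - Poly_Mapping.single {#x#} 1 - Poly_Mapping.single {#y#} 1
      \<in> sym_relations scaleA"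
      unfolding sym_relations_def by (intro UnI1 CollectI exI[of _ "{#}"]) auto
    from 1[OF this] show "incl (x + y) = incl x + incl y" by (simp add: E.diff E.add s algebra_simps)
    have "Poly_Mapping.single {#scaleA c x#} 1 - Poly_Mapping.single {#x#} c
      \<in> sym_relations scaleA"
      unfolding sym_relations_def by (intro UnI2 CollectI exI[of _ "{#}"]) auto
    from 1[OF this] show "incl (scaleA c x) = scaleS c (incl x)" by (simp add: E.diff s)
  qed
qed

lemma inj_incl: "inj incl"
proof
  fix x y assume xy: "incl x = incl y"
  define h where "h M = (if size M = 1 then sum_mset M else 0)" for M :: "'a multiset"
  have "\<exists>!L. Vector_Spaces.linear scaleS scaleA L \<and> (\<forall>w. L (prod_mset (image_mset incl w)) = h w)"
  proof (rule linear_extension)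
    fix r assume "r \<in> sym_relations scaleA"
    then show "formal_eval scaleA h r = 0"
      by (rule rel_eval[rotated -1])
        (auto simp: h_def A.vector_space_axioms)
  qed unfold_locales
  then obtain L where L: "\<And>w. L (prod_mset (image_mset incl w)) = h w" by blast
  from L[of "{#x#}"] L[of "{#y#}"] xy show "x = y" by (simp add: h_def)
qed

text \<open>Universal property of the symmetric algebra.\<close>

lemma universal:
  fixes scaleB :: "'k \<Rightarrow> 'd::comm_ring_1 \<Rightarrow> 'd"
  assumes B: "assoc_algebra scaleB" and h: "Vector_Spaces.linear scaleA scaleB h"
  shows "\<exists>!L. Vector_Spaces.linear scaleS scaleB L \<and> L 1 = 1 \<and>
    (\<forall>f g. L (f * g) = L f * L g) \<and> (\<forall>x. L (incl x) = h x)"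
proof -
  interpret B: assoc_algebra scaleB by fact
  interpret h: Vector_Spaces.linear scaleA scaleB h by fact
  interpret P: vector_space_pair scaleS scaleB by unfold_locales
  let ?w = "\<lambda>M. prod_mset (image_mset incl M)" and ?h = "\<lambda>M. prod_mset (image_mset h M)"
  have E: "\<exists>!L. Vector_Spaces.linear scaleS scaleB L \<and> (\<forall>w. L (?w w) = ?h w)"
  proof (rule linear_extension)
    fix r assume "r \<in> sym_relations scaleA"
    then show "formal_eval scaleB ?h r = 0"
      by (rule rel_eval[rotated -1])
        (auto simp: h.add h.scale distrib_left distrib_right B.vector_space_axioms
          B.scale_mult_left[symmetric] B.scale_mult_right[symmetric])
  qed unfold_locales
  then obtain L where L: "Vector_Spaces.linear scaleS scaleB L" "\<And>w. L (?w w) = ?h w" by blast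
  interpret L: Vector_Spaces.linear scaleS scaleB L by fact
  have span: "f \<in> span (range ?w)" for f using span_words by simp
  have mult: "L (f * g) = L f * L g" for f g
  proof -
    have 1: "L (?w u * g) = L (?w u) * L g" for u
    proof (rule P.linear_eq_on_span[where B = "range ?w", OF _ _ _ span])
      show "Vector_Spaces.linear scaleS scaleB (\<lambda>g. L (?w u * g))"
        by unfold_locales (simp_all add: distrib_left distrib_right L.add L.scale flip: scale_mult_right)
      show "Vector_Spaces.linear scaleS scaleB (\<lambda>g. L (?w u) * L g)"
        by unfold_locales (simp_all add: distrib_left distrib_right L.add L.scale flip: B.scale_mult_right)
      fix v assume "v \<in> range ?w"
      then obtain v' where "v = ?w v'" by auto
      then show "L (?w u * v) = L (?w u) * L v"
        using L(2)[of "u + v'"] by (simp add: L(2))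
    qed
    show ?thesis
    proof (rule P.linear_eq_on_span[where f = "\<lambda>f. L (f * g)" and g = "\<lambda>f. L f * L g"
          and B = "range ?w", OF _ _ _ span])
      show "Vector_Spaces.linear scaleS scaleB (\<lambda>f. L (f * g))"
        by unfold_locales (simp_all add: distrib_left distrib_right L.add L.scale flip: scale_mult_left)
      show "Vector_Spaces.linear scaleS scaleB (\<lambda>f. L f * L g)"
        by unfold_locales (simp_all add: distrib_left distrib_right L.add L.scale flip: B.scale_mult_left)
    qed (auto simp: 1)
  qed
  show ?thesis
  proof (rule ex1I[of _ L])
    show "Vector_Spaces.linear scaleS scaleB L \<and> L 1 = 1 \<and>
      (\<forall>f g. L (f * g) = L f * L g) \<and> (\<forall>x. L (incl x) = h x)"
      using L(1) L(2)[of "{#}"] L(2)[of "{#_#}"] mult by simp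
    fix M assume M: "Vector_Spaces.linear scaleS scaleB M \<and> M 1 = 1 \<and>
      (\<forall>f g. M (f * g) = M f * M g) \<and> (\<forall>x. M (incl x) = h x)"
    then have "M (?w w) = ?h w" for w by (induction w) auto
    then show "M = L" using E L M by blast
  qed
qed

end

section \<open>The symmetric algebra of an associative algebra\<close>

text \<open>\<open>sweedler scaleS incl H hs\<close> states that \<open>\<Sum>(p, q)\<leftarrow>hs. p \<otimes> q\<close> represents \<open>\<Delta>(H)\<close>, where
  \<open>\<Delta>\<close> is the algebra morphism for which the elements of \<open>A\<close> are primitive. A tensor in
  \<open>S(A) \<otimes> S(A)\<close> has many representing lists; this is harmless since Sweedler sums are only
  used below under bilinear maps.\<close>

inductive sweedler ::
  "('k::field \<Rightarrow> 's::comm_ring_1 \<Rightarrow> 's) \<Rightarrow> ('a \<Rightarrow> 's) \<Rightarrow> 's \<Rightarrow> ('s \<times> 's) list \<Rightarrow> bool"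
  for scaleS :: "'k::field \<Rightarrow> 's::comm_ring_1 \<Rightarrow> 's" and incl :: "'a \<Rightarrow> 's"
  where
    one: "sweedler scaleS incl 1 [(1, 1)]"
  | prim: "sweedler scaleS incl (incl y) [(incl y, 1), (1, incl y)]"
  | add: "sweedler scaleS incl G gs \<Longrightarrow> sweedler scaleS incl H hs \<Longrightarrow>
      sweedler scaleS incl (G + H) (gs @ hs)"
  | scale: "sweedler scaleS incl G gs \<Longrightarrow>
      sweedler scaleS incl (scaleS c G) (map (\<lambda>(p, q). (scaleS c p, q)) gs)"
  | mult: "sweedler scaleS incl G gs \<Longrightarrow> sweedler scaleS incl H hs \<Longrightarrow>
      sweedler scaleS incl (G * H)
        (concat (map (\<lambda>(p, q). map (\<lambda>(p', q'). (p * p', q * q')) hs) gs))"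

definition is_counit ::
  "('k::field \<Rightarrow> 's::comm_ring_1 \<Rightarrow> 's) \<Rightarrow> ('a \<Rightarrow> 's) \<Rightarrow> ('s \<Rightarrow> 'k) \<Rightarrow> bool"
  where "is_counit scaleS incl e \<longleftrightarrow>
    Vector_Spaces.linear scaleS (*) e \<and> e 1 = 1 \<and> (\<forall>G H. e (G * H) = e G * e H) \<and>
    (\<forall>y. e (incl y) = 0)"

text \<open>The product \<open>\<blacktriangleleft>\<close> on \<open>S(A)\<close> attached to an associative product \<open>op\<close> on \<open>A\<close>
  (indices start at 0).\<close>

definition is_sym_product ::
  "('k::field \<Rightarrow> 's::comm_ring_1 \<Rightarrow> 's) \<Rightarrow> ('a \<Rightarrow> 's) \<Rightarrow> ('a \<Rightarrow> 'a \<Rightarrow> 'a) \<Rightarrow>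
   ('s \<Rightarrow> 's \<Rightarrow> 's) \<Rightarrow> bool"
  where "is_sym_product scaleS incl op tri \<longleftrightarrow>
    bilinear_map scaleS scaleS scaleS tri \<and>
    (\<forall>xs ys. tri (prod_list (map incl xs)) (prod_list (map incl ys)) =
      (\<Sum>I\<in>Pow {..<length ys}. \<Sum>\<theta>\<in>{\<theta> \<in> I \<rightarrow>\<^sub>E {..<length xs}. inj_on \<theta> I}.
        (\<Prod>i\<in>{..<length xs} - \<theta> ` I. incl (xs ! i)) *
        (\<Prod>j\<in>{..<length ys} - I. incl (ys ! j)) *
        (\<Prod>i\<in>I. incl (op (xs ! \<theta> i) (ys ! i)))))"

definition tri_list :: "('s::comm_ring_1 \<Rightarrow> 's \<Rightarrow> 's) \<Rightarrow> ('a \<Rightarrow> 's) \<Rightarrow> 'a list \<Rightarrow> 's"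
  where "tri_list tri incl gs = foldl tri 1 (map incl gs)"

section \<open>The Lie algebra \<open>g\<^sub>a\<close> and its modules\<close>

text \<open>The index set \<open>{1, ..., N}\<close> is an arbitrary finite type \<open>'n\<close>, and \<open>\<epsilon>\<^sub>i\<close> is \<open>axis i 1\<close>.\<close>

definition ga_bracket :: "'k::field ^ 'n::finite \<Rightarrow> 'k ^ 'n \<Rightarrow> 'k ^ 'n \<Rightarrow> 'k ^ 'n"
  where "ga_bracket a u v =
    (\<Sum>i\<in>UNIV. \<Sum>j\<in>UNIV. (u $ i * v $ j) *s (a $ j *s axis i 1 - a $ i *s axis j 1))"

definition ga_product :: "'k::field ^ 'n::finite \<Rightarrow> 'k ^ 'n \<Rightarrow> 'k ^ 'n \<Rightarrow> 'k ^ 'n"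
  where "ga_product a u v =
    (\<Sum>i\<in>UNIV. \<Sum>j\<in>UNIV. (u $ i * v $ j) *s (a $ j *s axis i 1))"

definition ga_action ::
  "('k::field \<Rightarrow> 'v::ab_group_add \<Rightarrow> 'v) \<Rightarrow> ('n::finite \<Rightarrow> 'v \<Rightarrow> 'v) \<Rightarrow> 'k ^ 'n \<Rightarrow> 'v \<Rightarrow> 'v"
  where "ga_action scaleV F u x = (\<Sum>i\<in>UNIV. scaleV (u $ i) (F i x))"

definition is_ga_module ::
  "'k::field ^ 'n::finite \<Rightarrow> ('k \<Rightarrow> 'v::ab_group_add \<Rightarrow> 'v) \<Rightarrow> ('n \<Rightarrow> 'v \<Rightarrow> 'v) \<Rightarrow> bool"
  where "is_ga_module a scaleV F \<longleftrightarrow>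
    (\<forall>i. Vector_Spaces.linear scaleV scaleV (F i)) \<and>
    (\<forall>u v x. ga_action scaleV F (ga_bracket a u v) x =
      ga_action scaleV F u (ga_action scaleV F v x)
      - ga_action scaleV F v (ga_action scaleV F u x))"

text \<open>\<open>\<phi>\<^sub>V\<close>: the morphism from \<open>(S(g\<^sub>a), \<blacktriangleleft>)\<close> to \<open>End(V)\<close> sending \<open>\<epsilon>\<^sub>i\<close> to \<open>F\<^sub>i\<close>.\<close>

definition is_action_morphism ::
  "('k::field \<Rightarrow> 'v::ab_group_add \<Rightarrow> 'v) \<Rightarrow> ('n::finite \<Rightarrow> 'v \<Rightarrow> 'v) \<Rightarrow>
   ('k \<Rightarrow> 's::comm_ring_1 \<Rightarrow> 's) \<Rightarrow> ('k ^ 'n \<Rightarrow> 's) \<Rightarrow> ('s \<Rightarrow> 's \<Rightarrow> 's) \<Rightarrow>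
   ('s \<Rightarrow> 'v \<Rightarrow> 'v) \<Rightarrow> bool"
  where "is_action_morphism scaleV F scaleS incl tri \<phi> \<longleftrightarrow>
    bilinear_map scaleS scaleV scaleV \<phi> \<and>
    \<phi> 1 = id \<and> (\<forall>G H. \<phi> (tri G H) = \<phi> G \<circ> \<phi> H) \<and> (\<forall>i. \<phi> (incl (axis i 1)) = F i)"

section \<open>Products on \<open>T(V)\<close> and \<open>T(V)\<^sup>N\<close>\<close>

text \<open>The element \<open>f \<epsilon>\<^sub>i\<close> of \<open>T(V)\<^sup>N\<close> is \<open>axis i f\<close>.\<close>

definition vec_scale :: "('k \<Rightarrow> 't \<Rightarrow> 't) \<Rightarrow> 'k \<Rightarrow> 't ^ 'n \<Rightarrow> 't ^ 'n"
  where "vec_scale scaleT c u = (\<chi> i. scaleT c (u $ i))"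

definition lconcat :: "('v \<Rightarrow> 't::ring_1) \<Rightarrow> 'v \<Rightarrow> 't ^ 'n \<Rightarrow> 't ^ 'n"
  where "lconcat incl x u = (\<chi> i. incl x * u $ i)"

definition is_shuffle ::
  "('k::field \<Rightarrow> 't::ring_1 \<Rightarrow> 't) \<Rightarrow> ('v \<Rightarrow> 't) \<Rightarrow> ('t \<Rightarrow> 't \<Rightarrow> 't) \<Rightarrow> bool"
  where "is_shuffle scaleT incl sh \<longleftrightarrow>
    bilinear_map scaleT scaleT scaleT sh \<and>
    (\<forall>f. sh 1 f = f) \<and> (\<forall>f. sh f 1 = f) \<and>
    (\<forall>x y f g. sh (incl x * f) (incl y * g) =
      incl x * sh f (incl y * g) + incl y * sh (incl x * f) g)"

definition sh_at :: "('t \<Rightarrow> 't \<Rightarrow> 't) \<Rightarrow> 'n \<Rightarrow> 't ^ 'n \<Rightarrow> 't ^ 'n \<Rightarrow> 't ^ 'n"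
  where "sh_at sh j u v = (\<chi> i. sh (u $ i) (v $ j))"

text \<open>\<open>u sh\<^sub>j\<^sub>1 u\<^sub>1 ... sh\<^sub>j\<^sub>l u\<^sub>l\<close>, bracketed from the left.\<close>

definition sh_iter ::
  "('t \<Rightarrow> 't \<Rightarrow> 't) \<Rightarrow> 't ^ 'n \<Rightarrow> 'n list \<Rightarrow> ('t ^ 'n) list \<Rightarrow> 't ^ 'n"
  where "sh_iter sh u js us = foldl (\<lambda>w (j, v). sh_at sh j w v) u (zip js us)"

definition a_sh ::
  "'k::field ^ 'n::finite \<Rightarrow> ('k \<Rightarrow> 't::ring_1 \<Rightarrow> 't) \<Rightarrow> ('t \<Rightarrow> 't \<Rightarrow> 't) \<Rightarrow>
   't ^ 'n \<Rightarrow> 't ^ 'n \<Rightarrow> 't ^ 'n"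
  where "a_sh a scaleT sh u v =
    (\<Sum>i\<in>UNIV. \<Sum>j\<in>UNIV. axis j (scaleT (a $ i) (sh (u $ i) (v $ j))))"

definition is_star ::
  "('k::field \<Rightarrow> 't::ring_1 \<Rightarrow> 't) \<Rightarrow> ('v \<Rightarrow> 't) \<Rightarrow> ('t \<Rightarrow> 't \<Rightarrow> 't) \<Rightarrow>
   ('n::finite \<Rightarrow> 'v \<Rightarrow> 'v) \<Rightarrow> ('t ^ 'n \<Rightarrow> 't ^ 'n \<Rightarrow> 't ^ 'n) \<Rightarrow> bool"
  where "is_star scaleT incl sh F star \<longleftrightarrow>
    bilinear_map (vec_scale scaleT) (vec_scale scaleT) (vec_scale scaleT) star \<and>
    (\<forall>i j g. star (axis i 1) (axis j g) = 0) \<and>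
    (\<forall>x f i j g. star (axis i (incl x * f)) (axis j g) =
      lconcat incl x (star (axis i f) (axis j g)) + axis i (incl (F j x) * sh f g))"

text \<open>The extension \<open>starS\<close> of a product \<open>star\<close> on \<open>A\<close> to \<open>S(A)\<close>.\<close>

definition is_star_extension ::
  "('k::field \<Rightarrow> 's::comm_ring_1 \<Rightarrow> 's) \<Rightarrow> ('a \<Rightarrow> 's) \<Rightarrow> ('s \<Rightarrow> 's \<Rightarrow> 's) \<Rightarrow> ('s \<Rightarrow> 'k) \<Rightarrow>
   ('a \<Rightarrow> 'a \<Rightarrow> 'a) \<Rightarrow> ('s \<Rightarrow> 's \<Rightarrow> 's) \<Rightarrow> bool"
  where "is_star_extension scaleS incl tri e star starS \<longleftrightarrow>
    bilinear_map scaleS scaleS scaleS starS \<and>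
    (\<forall>u v. starS (incl u) (incl v) = incl (star u v)) \<and>
    (\<forall>G. starS G 1 = G) \<and>
    (\<forall>G. starS 1 G = scaleS (e G) 1) \<and>
    (\<forall>G H y. starS G (tri H (incl y)) = starS (starS G H) (incl y) - starS G (starS H (incl y))) \<and>
    (\<forall>G H K hs. sweedler scaleS incl K hs \<longrightarrow>
      starS (tri G H) K = (\<Sum>(k1, k2)\<leftarrow>hs. tri (starS G k1) (starS H k2)))"

text \<open>The action of \<open>S(A)\<close> on \<open>A\<close>, using that \<open>incl\<close> is injective and that
  \<open>A * S(A)\<close> is contained in \<open>A\<close>.\<close>

definition star_act :: "('a \<Rightarrow> 's) \<Rightarrow> ('s \<Rightarrow> 's \<Rightarrow> 's) \<Rightarrow> 'a \<Rightarrow> 's \<Rightarrow> 'a"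
  where "star_act incl starS u G = the_inv incl (starS (incl u) G)"

end

theory Submission
  imports Defs
begin

text \<open>Right multiplication by \<open>y \<in> T(V)\<^sup>N\<close> acts on all components by one derivation of the shuffle
  product, so it is a derivation of \<open>\<triangleleft>\<close>, hence of \<open>\<blacktriangleleft>\<close> and of the commutative product of
  \<open>S(g'\<^sub>a)\<close>. Write \<open>f \<cdot> gs\<close> for \<open>f\<close> times the product of a list \<open>gs\<close>. For either product,
  \<open>f \<cdot> (gs, y)\<close> is \<open>(f \<cdot> gs) * y\<close> minus the sums over the entries \<open>g\<close> of \<open>gs\<close> of \<open>f \<cdot> gs\<close> with
  \<open>g\<close> replaced by \<open>g * y\<close> and by \<open>g \<triangleleft>\<^sub>b y\<close>, where \<open>b = 0\<close> for \<open>\<blacktriangleleft>\<close> and \<open>b = a\<close> for the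
  commutative product. Correspondingly, the coefficient of \<open>(js, j)\<close> is \<open>F\<^sub>j\<close> of that of \<open>js\<close>,
  minus the sum over the entries \<open>p\<close> of \<open>js\<close> of \<open>b\<^sub>p\<close> times the coefficient of \<open>js\<close> with \<open>p\<close>
  replaced by \<open>j\<close>. Induction on the length of \<open>gs\<close> gives both expansions at once: in the shuffle
  slots the replacements \<open>g * y\<close> cancel by the derivation property, and the replacements
  \<open>g \<triangleleft>\<^sub>b y\<close> are absorbed by the coefficients after exchanging \<open>p\<close> and \<open>j\<close>.\<close>

lemma bilinear_mapD:
  assumes "bilinear_map s1 s2 s3 m"
  shows "m (u + u') v = m u v + m u' v" "m u (v + v') = m u v + m u v'"
    "m (u - u') v = m u v - m u' v" "m u (v - v') = m u v - m u v'"
    "m (s1 c u) v = s3 c (m u v)" "m u (s2 c v) = s3 c (m u v)"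
    "m 0 v = 0" "m u 0 = 0"
    "m (sum p I) v = (\<Sum>i\<in>I. m (p i) v)" "m u (sum q J) = (\<Sum>j\<in>J. m u (q j))"
proof -
  interpret L: Vector_Spaces.linear s1 s3 "\<lambda>u. m u v" using assms by (simp add: bilinear_map_def)
  interpret R: Vector_Spaces.linear s2 s3 "\<lambda>v. m u v" using assms by (simp add: bilinear_map_def)
  show "m (u + u') v = m u v + m u' v" "m u (v + v') = m u v + m u v'"
    "m (u - u') v = m u v - m u' v" "m u (v - v') = m u v - m u v'"
    "m (s1 c u) v = s3 c (m u v)" "m u (s2 c v) = s3 c (m u v)"
    "m 0 v = 0" "m u 0 = 0"
    "m (sum p I) v = (\<Sum>i\<in>I. m (p i) v)" "m u (sum q J) = (\<Sum>j\<in>J. m u (q j))"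
    by (fact L.add R.add L.diff R.diff L.scale R.scale L.zero R.zero L.sum R.sum)+
qed

section \<open>Sums over the entries and over the sublists of a list\<close>

text \<open>When \<open>P\<close> multiplies the entries of a list and \<open>d\<close> is a
  derivation, this is the Leibniz expansion of \<open>d\<close> on the product.\<close>

definition slot_sum :: "('a \<Rightarrow> 'a) \<Rightarrow> ('a list \<Rightarrow> 'b::comm_monoid_add) \<Rightarrow> 'a list \<Rightarrow> 'b"
  where "slot_sum d P gs = (\<Sum>m<length gs. P (gs[m := d (gs ! m)]))"

lemma slot_sum_Nil [simp]: "slot_sum d P [] = 0"
  by (simp add: slot_sum_def)

lemma slot_sum_Cons [simp]:
  "slot_sum d P (g # gs) = P (d g # gs) + slot_sum d (\<lambda>hs. P (g # hs)) gs"
  by (simp add: slot_sum_def sum.lessThan_Suc_shift del: sum.lessThan_Suc)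

lemma slot_sum_snoc:
  "slot_sum d P (gs @ [g]) = slot_sum d (\<lambda>hs. P (hs @ [g])) gs + P (gs @ [d g])"
  by (simp add: slot_sum_def nth_append list_update_append)

lemma slot_sum_cong:
  assumes "\<And>hs. length hs = length gs \<Longrightarrow> P hs = Q hs"
  shows "slot_sum d P gs = slot_sum d Q gs"
  by (simp add: slot_sum_def assms)

lemma slot_sum_add:
  "slot_sum d (\<lambda>hs. P hs + Q hs) gs = slot_sum d P gs + slot_sum d Q gs"
  by (simp add: slot_sum_def sum.distrib)

lemma slot_sum_sum:
  "slot_sum d (\<lambda>hs. \<Sum>i\<in>I. P i hs) gs = (\<Sum>i\<in>I. slot_sum d (P i) gs)"
  unfolding slot_sum_def by (rule sum.swap)

text \<open>Replacements in different slots commute. A discrepancy arises only where both hit the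
  same slot, and the assumption identifies it with \<open>c\<close>.\<close>

lemma slot_sum_commute:
  assumes "\<And>us ws g. P (us @ d (e g) # ws) = P (us @ e (d g) # ws) + P (us @ c g # ws)"
  shows "slot_sum e (slot_sum d P) gs = slot_sum d (slot_sum e P) gs + slot_sum c P gs"
  using assms
proof (induction gs arbitrary: P)
  case (Cons g gs)
  have "slot_sum e (slot_sum d (\<lambda>hs. P (g # hs))) gs =
      slot_sum d (slot_sum e (\<lambda>hs. P (g # hs))) gs + slot_sum c (\<lambda>hs. P (g # hs)) gs"
    by (rule Cons.IH) (use Cons.prems[of "g # _"] in simp)
  then show ?case
    using Cons.prems[of "[]"] by (simp add: slot_sum_add add_ac)
qed simp

text \<open>The recursive form of a sum over sets \<open>I\<close> of indices: \<open>us\<close>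
  collects the entries at \<open>I\<close> and \<open>ws\<close> the others, both in their original
  order.\<close>

primrec split_sum :: "('a list \<Rightarrow> 'a list \<Rightarrow> 'b::comm_monoid_add) \<Rightarrow> 'a list \<Rightarrow> 'b"
  where
    "split_sum Q [] = Q [] []"
  | "split_sum Q (g # gs) =
      split_sum (\<lambda>us ws. Q (g # us) ws) gs + split_sum (\<lambda>us ws. Q us (g # ws)) gs"

lemma split_sum_add:
  "split_sum (\<lambda>us ws. P us ws + Q us ws) gs = split_sum P gs + split_sum Q gs"
  by (induction gs arbitrary: P Q) (simp_all add: add_ac)

lemma split_sum_diff:
  fixes P Q :: "'a list \<Rightarrow> 'a list \<Rightarrow> 'b::ab_group_add"
  shows "split_sum (\<lambda>us ws. P us ws - Q us ws) gs = split_sum P gs - split_sum Q gs"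
  using split_sum_add[of "\<lambda>us ws. P us ws - Q us ws" Q gs] by simp

lemma split_sum_hom:
  assumes "\<And>p q. h (p + q) = h p + h q"
  shows "h (split_sum Q gs) = split_sum (\<lambda>us ws. h (Q us ws)) gs"
  by (induction gs arbitrary: Q) (simp_all add: assms)

lemma split_sum_snoc:
  "split_sum Q (gs @ [y]) =
    split_sum (\<lambda>us ws. Q (us @ [y]) ws) gs + split_sum (\<lambda>us ws. Q us (ws @ [y])) gs"
  by (induction gs arbitrary: Q) (simp_all add: add_ac)

text \<open>Every entry lies in exactly one of the two sublists, so replacing it is a replacement in
  that sublist.\<close>

lemma slot_sum_split_sum:
  "slot_sum d (split_sum Q) gs =
    split_sum (\<lambda>us ws. slot_sum d (\<lambda>us. Q us ws) us + slot_sum d (Q us) ws) gs"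
  by (induction gs arbitrary: Q) (simp_all add: slot_sum_add split_sum_add add_ac)

lemma split_sum_nths:
  "(\<Sum>I\<in>Pow {..<length gs}. Q (nths gs I) (nths gs (- I))) = split_sum Q gs"
proof (induction gs arbitrary: Q)
  case (Cons g gs)
  \<comment> \<open>Subsets of the indices of \<open>g # gs\<close> are shifted subsets of those of
    \<open>gs\<close>, without or with \<open>0\<close>.\<close>
  have *: "Pow {..<length (g # gs)} =
      (`) Suc ` Pow {..<length gs} \<union> (\<lambda>I. insert 0 (Suc ` I)) ` Pow {..<length gs}"
    by (simp add: lessThan_Suc_eq_insert_0 Pow_insert image_image flip: image_Pow_surj[OF refl])
  have inj: "inj ((`) Suc)" "inj (\<lambda>I. insert 0 (Suc ` I))"
    by (auto intro!: injI simp: set_eq_iff image_iff)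
  have "{j. Suc j \<in> - (Suc ` I)} = - I" "{j. Suc j \<in> - insert 0 (Suc ` I)} = - I" for I
    by auto
  then show ?case
    unfolding *
    by (subst sum.union_disjoint)
      (auto simp: sum.reindex inj_on_subset[OF inj(1)] inj_on_subset[OF inj(2)]
        nths_Cons image_iff add.commute simp flip: Cons.IH)
qed simp

section \<open>Shuffles and the product \<open>*\<close>\<close>

lemma sum_lists_Cons:
  fixes P :: "'n::finite list \<Rightarrow> 'b::comm_monoid_add"
  shows "(\<Sum>js | length js = Suc n. P js) = (\<Sum>j\<in>UNIV. \<Sum>js | length js = n. P (j # js))"
proof -
  have fin: "finite {js :: 'n list. length js = n}"
    using finite_lists_length_eq[of "UNIV :: 'n set" n] by simp
  have "{js :: 'n list. length js = Suc n} = (\<lambda>(j, js). j # js) ` (UNIV \<times> {js. length js = n})"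
    by (auto simp: length_Suc_conv image_iff)
  then show ?thesis
    by (simp add: sum.reindex inj_on_def sum.cartesian_product case_prod_beta)
qed

locale shuffle_star = tensor_algebra scaleV scaleT incl
  for scaleV :: "'k::field \<Rightarrow> 'v::ab_group_add \<Rightarrow> 'v"
    and scaleT :: "'k \<Rightarrow> 't::ring_1 \<Rightarrow> 't" and incl :: "'v \<Rightarrow> 't" +
  fixes sh :: "'t \<Rightarrow> 't \<Rightarrow> 't" and F :: "'n::finite \<Rightarrow> 'v \<Rightarrow> 'v"
    and star :: "'t ^ 'n \<Rightarrow> 't ^ 'n \<Rightarrow> 't ^ 'n"
  assumes shuffle: "is_shuffle scaleT incl sh"
    and star: "is_star scaleT incl sh F star"
begin

text \<open>Words span T(V) and arise from the empty word by left concatenation; linearity does the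
  rest.\<close>

lemma tensor_induct [case_names one concat add scale]:
  assumes one: "P 1" and concat: "\<And>x f. P f \<Longrightarrow> P (incl x * f)"
    and add: "\<And>f g. P f \<Longrightarrow> P g \<Longrightarrow> P (f + g)" and scale: "\<And>c f. P f \<Longrightarrow> P (scaleT c f)"
  shows "P f"
proof -
  have word: "P (prod_list (map incl xs))" for xs
    by (induction xs) (simp_all add: one concat)
  have "f \<in> span (range (\<lambda>xs. prod_list (map incl xs)))"
    using span_words by simp
  then show ?thesis
  proof (induction rule: span_induct_alt)
    case base
    then show ?case using scale[OF one, of 0] by simp
  qed (use word in \<open>auto intro: add scale\<close>)
qed

lemma sh_bilinear: "bilinear_map scaleT scaleT scaleT sh"
  and sh_one [simp]: "sh 1 f = f" "sh f 1 = f"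
  and sh_concat: "sh (incl x * f) (incl y * g) =
      incl x * sh f (incl y * g) + incl y * sh (incl x * f) g"
  using shuffle by (auto simp: is_shuffle_def)

sublocale vec: vector_space "vec_scale scaleT :: 'k \<Rightarrow> 't ^ 'n \<Rightarrow> 't ^ 'n"
  by unfold_locales (simp_all add: vec_scale_def vec_eq_iff scale_left_distrib scale_right_distrib)

lemma star_bilinear: "bilinear_map (vec_scale scaleT) (vec_scale scaleT) (vec_scale scaleT) star"
  using star by (simp add: is_star_def)

lemmas sh_simps = bilinear_mapD[OF sh_bilinear]
lemmas star_simps = bilinear_mapD[OF star_bilinear]
lemmas incl_simps = module_hom.add[OF Vector_Spaces.linear.axioms(3)[OF linear_incl]]
  module_hom.diff[OF Vector_Spaces.linear.axioms(3)[OF linear_incl]]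
  module_hom.scale[OF Vector_Spaces.linear.axioms(3)[OF linear_incl]]
  module_hom.sum[OF Vector_Spaces.linear.axioms(3)[OF linear_incl]]

lemma sh_commute: "sh f g = sh g f"
proof (induction f arbitrary: g rule: tensor_induct)
  case (concat x f)
  show ?case
    by (induction g rule: tensor_induct) (simp_all add: sh_concat sh_simps concat.IH add.commute)
qed (simp_all add: sh_simps)

lemma sh_assoc: "sh (sh f g) h = sh f (sh g h)"
proof (induction f arbitrary: g h rule: tensor_induct)
  case f: (concat x f)
  show ?case
  proof (induction g arbitrary: h rule: tensor_induct)
    case g: (concat y g)
    show ?case
    proof (induction h rule: tensor_induct)
      case h: (concat z h)
      \<comment> \<open>Both bracketings split into three terms according to the first letter; in
        each, one factor has lost its own.\<close>
      have "sh (sh (incl x * f) (incl y * g)) (incl z * h) =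
          incl x * sh (sh f (incl y * g)) (incl z * h)
          + incl y * sh (sh (incl x * f) g) (incl z * h)
          + incl z * sh (sh (incl x * f) (incl y * g)) h"
        by (simp add: sh_concat sh_simps distrib_left add_ac)
      also have "\<dots> = sh (incl x * f) (sh (incl y * g) (incl z * h))"
        by (simp add: f.IH g.IH h.IH)
          (simp add: sh_concat sh_simps distrib_left add_ac)
      finally show ?case .
    qed (simp_all add: sh_simps)
  qed (simp_all add: sh_simps)
qed (simp_all add: sh_simps)

lemma sh_left_commute: "sh f (sh g h) = sh g (sh f h)"
  by (metis sh_assoc sh_commute)

section \<open>Right multiplication on \<open>T(V)^N\<close> as a derivation of the shuffle
  product\<close>

lemma axis_linear:
  "axis i (f + g) = axis i f + axis i g"
  "axis i (scaleT c f) = vec_scale scaleT c (axis i f)"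
  for f g :: 't and i :: 'n
  by (simp_all add: vec_eq_iff axis_def vec_scale_def)

lemma vec_sum_axis: "u = (\<Sum>i\<in>UNIV. axis i (u $ i))" for u :: "'t ^ 'n"
  by (simp add: vec_eq_iff axis_def)

lemma star_axis_one: "star (axis i 1) y = 0"
  using star by (subst vec_sum_axis[of y]) (simp add: star_simps is_star_def)

lemma lconcat_axis: "lconcat incl x (axis i f) = axis i (incl x * f)"
  by (simp add: lconcat_def axis_def vec_eq_iff)

lemma lconcat_simps:
  "lconcat incl x (u + w) = lconcat incl x u + lconcat incl x w"
  "lconcat incl x (u - w) = lconcat incl x u - lconcat incl x w"
  "lconcat incl x (vec_scale scaleT c u) = vec_scale scaleT c (lconcat incl x u)"
  "lconcat incl x (sum p I) = (\<Sum>i\<in>I. lconcat incl x (p i))"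
  "lconcat incl (x + x') u = lconcat incl x u + lconcat incl x' u"
  "lconcat incl (x - x') u = lconcat incl x u - lconcat incl x' u"
  "lconcat incl (scaleV c x) u = vec_scale scaleT c (lconcat incl x u)"
  "lconcat incl (sum q J) u = (\<Sum>j\<in>J. lconcat incl (q j) u)"
  by (simp_all add: vec_eq_iff lconcat_def vec_scale_def incl_simps algebra_simps
      sum_distrib_left sum_distrib_right scale_mult_left scale_mult_right
      flip: scale_mult_left scale_mult_right)

lemma star_axis_concat:
  "star (axis i (incl x * f)) y =
    lconcat incl x (star (axis i f) y) + axis i (\<Sum>j\<in>UNIV. incl (F j x) * sh f (y $ j))"
proof -
  have "star (axis i (incl x * f)) (\<Sum>j\<in>UNIV. axis j (y $ j)) =
      lconcat incl x (star (axis i f) (\<Sum>j\<in>UNIV. axis j (y $ j)))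
      + (\<Sum>j\<in>UNIV. axis i (incl (F j x) * sh f (y $ j)))"
    using star by (simp add: star_simps is_star_def lconcat_simps sum.distrib)
  moreover have "(\<Sum>j\<in>UNIV. axis i (incl (F j x) * sh f (y $ j))) =
      axis i (\<Sum>j\<in>UNIV. incl (F j x) * sh f (y $ j))"
    by (simp add: vec_eq_iff axis_def)
  ultimately show ?thesis by (simp flip: vec_sum_axis)
qed

text \<open>Right multiplication by \<open>y\<close> acts on every component by the same endomorphism of \<open>T(V)\<close>,
  read off here from an arbitrary component.\<close>

definition act :: "'t ^ 'n \<Rightarrow> 't \<Rightarrow> 't"
  where "act y f = star (axis undefined f) y $ undefined"

lemma act_simps:
  "act y (f + g) = act y f + act y g"
  "act y (scaleT c f) = scaleT c (act y f)"
  "act y (sum p I) = (\<Sum>i\<in>I. act y (p i))"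
  "act y 1 = 0"
proof -
  show add: "act y (f + g) = act y f + act y g" for f g
    by (simp add: act_def axis_linear star_simps)
  show scale: "act y (scaleT c f) = scaleT c (act y f)" for c f
    by (simp add: act_def axis_linear star_simps) (simp add: vec_scale_def)
  show "act y (sum p I) = (\<Sum>i\<in>I. act y (p i))"
    using scale[of 0 0] by (induction I rule: infinite_finite_induct) (simp_all add: add)
  show "act y 1 = 0"
    by (simp add: act_def star_axis_one)
qed

lemma act_concat:
  "act y (incl x * f) = incl x * act y f + (\<Sum>j\<in>UNIV. incl (F j x) * sh f (y $ j))"
  by (simp add: act_def star_axis_concat lconcat_def del: axis_eq_axis)

text \<open>The recursion for \<open>star\<close> treats all components of the left argument alike,
  so the choice of component in \<open>act\<close> does not matter.\<close>

lemma star_axis: "star (axis i f) y = axis i (act y f)"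
proof (induction f arbitrary: i rule: tensor_induct)
  case one
  show ?case by (simp add: act_simps star_axis_one)
qed (simp_all add: star_axis_concat act_concat act_simps lconcat_axis axis_linear star_simps)

lemma star_nth: "star u y $ i = act y (u $ i)"
proof -
  have "star (\<Sum>i\<in>UNIV. axis i (u $ i)) y $ i = act y (u $ i)"
    by (simp add: star_simps star_axis) (simp add: axis_def)
  then show ?thesis by (simp flip: vec_sum_axis)
qed

text \<open>Terms headed by \<open>F j x\<close> or \<open>F j z\<close> agree on both sides since
  shuffling is associative and commutative; the others match by induction.\<close>

lemma act_sh: "act y (sh f g) = sh (act y f) g + sh f (act y g)"
proof (induction f arbitrary: g rule: tensor_induct)
  case f: (concat x f)
  show ?case
  proof (induction g rule: tensor_induct)
    case g: (concat z g)
    show ?case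
      by (simp add: sh_concat act_simps act_concat f.IH g.IH sh_simps distrib_left sum_distrib_left
          sum.distrib algebra_simps)
        (simp add: sh_assoc sh_commute sh_left_commute)
  qed (simp_all add: sh_simps act_simps scale_right_distrib)
qed (simp_all add: sh_simps act_simps scale_right_distrib)

lemma star_lconcat:
  "star (lconcat incl x w) y =
    lconcat incl x (star w y) + (\<Sum>j\<in>UNIV. lconcat incl (F j x) (sh_at sh j w y))"
  by (simp add: vec_eq_iff star_nth lconcat_def act_concat sh_at_def)

lemma sh_at_simps:
  "sh_at sh j (u + u') v = sh_at sh j u v + sh_at sh j u' v"
  "sh_at sh j (sum p I) v = (\<Sum>i\<in>I. sh_at sh j (p i) v)"
  "sh_at sh j (vec_scale scaleT c u) v = vec_scale scaleT c (sh_at sh j u v)"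
  by (simp_all add: vec_eq_iff sh_at_def sh_simps vec_scale_def)

text \<open>Each \<open>sh_at\<close> shuffles all components with one fixed element of T(V), and
  such multiplications commute.\<close>

lemma sh_at_commute: "sh_at sh i (sh_at sh j u v) w = sh_at sh j (sh_at sh i u w) v"
  by (simp add: vec_eq_iff sh_at_def sh_assoc sh_commute sh_left_commute)

lemma star_sh_at: "star (sh_at sh j w v) y = sh_at sh j (star w y) v + sh_at sh j w (star v y)"
  by (simp add: vec_eq_iff star_nth sh_at_def act_sh)

lemma a_sh_nth: "a_sh b scaleT sh u v $ j = (\<Sum>i\<in>UNIV. scaleT (b $ i) (sh (u $ i) (v $ j)))"
  by (simp add: a_sh_def axis_def if_distrib)

lemma star_a_sh:
  "star (a_sh b scaleT sh u v) y =
    a_sh b scaleT sh (star u y) v + a_sh b scaleT sh u (star v y)"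
  by (simp add: vec_eq_iff star_nth a_sh_nth act_simps act_sh scale_right_distrib sum.distrib)

text \<open>Component \<open>q\<close> of the product of \<open>u\<close> and \<open>y\<close> is a
  weighted sum of shuffles of \<open>u $ p\<close> and \<open>y $ q\<close>; by associativity these
  can be shuffled in one after the other.\<close>

lemma sh_at_a_sh:
  "sh_at sh q w (a_sh b scaleT sh u y) =
    (\<Sum>p\<in>UNIV. vec_scale scaleT (b $ p) (sh_at sh q (sh_at sh p w u) y))"
  by (simp add: vec_eq_iff sh_at_def a_sh_nth vec_scale_def sh_simps sh_assoc)

section \<open>Sums of iterated shuffles over lists of indices\<close>

lemma sh_iter_Nil [simp]: "sh_iter sh w js [] = w"
  and sh_iter_Cons [simp]: "sh_iter sh w (j # js) (u # us) = sh_iter sh (sh_at sh j w u) js us"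
  by (simp_all add: sh_iter_def)

text \<open>The inner sum of the expansion for a fixed set \<open>I\<close>; \<open>C\<close> is
  left free to cover both kinds of coefficients.\<close>

definition index_sum :: "('n list \<Rightarrow> 'v) \<Rightarrow> ('t ^ 'n) list \<Rightarrow> 't ^ 'n \<Rightarrow> 't ^ 'n"
  where "index_sum C us w =
    (\<Sum>js | length js = length us. lconcat incl (C js) (sh_iter sh w js us))"

lemma index_sum_Nil [simp]: "index_sum C [] w = lconcat incl (C []) w"
  by (simp add: index_sum_def)

lemma index_sum_Cons [simp]:
  "index_sum C (u # us) w = (\<Sum>q\<in>UNIV. index_sum (\<lambda>js. C (q # js)) us (sh_at sh q w u))"
  by (simp add: index_sum_def sum_lists_Cons)

lemma index_sum_simps:
  "index_sum C us (w + w') = index_sum C us w + index_sum C us w'"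
  "index_sum C us (vec_scale scaleT c w) = vec_scale scaleT c (index_sum C us w)"
  "index_sum C us (sum p I) = (\<Sum>i\<in>I. index_sum C us (p i))"
  "index_sum (\<lambda>js. D js + E js) us w = index_sum D us w + index_sum E us w"
  "index_sum (\<lambda>js. D js - E js) us w = index_sum D us w - index_sum E us w"
  "index_sum (\<lambda>js. scaleV c (C js)) us w = vec_scale scaleT c (index_sum C us w)"
proof -
  show "index_sum C us (sum p I) = (\<Sum>i\<in>I. index_sum C us (p i))"
    by (induction us arbitrary: C p) (simp_all add: sh_at_simps lconcat_simps sum.swap[of _ I])
qed (induction us arbitrary: C D E w w';
    simp add: sh_at_simps lconcat_simps sum.distrib sum_subtractf
      vec.scale_right_distrib vec.scale_sum_right)+

text \<open>The correction to the coefficients; for \<open>b = a\<close> it comes from \<open>\<epsilon>\<^sub>j \<triangleleft> \<epsilon>\<^sub>p = a\<^sub>p \<epsilon>\<^sub>j\<close>.\<close>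

definition slot_coeff :: "'k ^ 'n \<Rightarrow> ('n list \<Rightarrow> 'v) \<Rightarrow> 'n list \<Rightarrow> 'n \<Rightarrow> 'v"
  where "slot_coeff b C js j = (\<Sum>m<length js. scaleV (b $ (js ! m)) (C (js[m := j])))"

lemma slot_coeff_Nil [simp]: "slot_coeff b C [] j = 0"
  by (simp add: slot_coeff_def)

lemma slot_coeff_Cons [simp]:
  "slot_coeff b C (p # js) j =
    scaleV (b $ p) (C (j # js)) + slot_coeff b (\<lambda>js. C (p # js)) js j"
  by (simp add: slot_coeff_def sum.lessThan_Suc_shift del: sum.lessThan_Suc)

text \<open>The iterated shuffles commute, so the last one can be carried out first.\<close>

lemma index_sum_snoc:
  "index_sum C (us @ [y]) w =
    (\<Sum>j\<in>UNIV. index_sum (\<lambda>js. C (js @ [j])) us (sh_at sh j w y))"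
proof (induction us arbitrary: C w)
  case (Cons u us)
  then show ?case by (simp add: sh_at_commute[where w = y]) (rule sum.swap)
qed simp

text \<open>By the derivation property, \<open>y\<close> meets \<open>w\<close>, a shuffled entry or
  the leading letter. In the last case \<open>F j\<close> is applied to the letter and
  \<open>y $ j\<close> is shuffled in.\<close>

lemma star_index_sum:
  "star (index_sum C us w) y =
    index_sum C us (star w y) + slot_sum (\<lambda>u. star u y) (\<lambda>us. index_sum C us w) us
    + (\<Sum>j\<in>UNIV. index_sum (\<lambda>js. F j (C js)) us (sh_at sh j w y))"
proof (induction us arbitrary: C w)
  case (Cons u us)
  let ?v = "\<lambda>q. sh_at sh q w u" and ?C = "\<lambda>q js. C (q # js)"
  let ?R = "\<lambda>q j. index_sum (\<lambda>js. F j (?C q js)) us (sh_at sh j (?v q) y)"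
  have "star (index_sum C (u # us) w) y =
      (\<Sum>q\<in>UNIV. index_sum (?C q) us (star (?v q) y))
      + (\<Sum>q\<in>UNIV. slot_sum (\<lambda>u. star u y) (\<lambda>us. index_sum (?C q) us (?v q)) us)
      + (\<Sum>q\<in>UNIV. \<Sum>j\<in>UNIV. ?R q j)"
    by (simp only: index_sum_Cons star_simps Cons.IH sum.distrib)
  also have "(\<Sum>q\<in>UNIV. \<Sum>j\<in>UNIV. ?R q j) =
      (\<Sum>j\<in>UNIV. index_sum (\<lambda>js. F j (C js)) (u # us) (sh_at sh j w y))"
    by (simp add: sh_at_commute[where w = y]) (rule sum.swap)
  also have "(\<Sum>q\<in>UNIV. index_sum (?C q) us (star (?v q) y)) =
      index_sum C (u # us) (star w y) + index_sum C (star u y # us) w"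
    by (simp add: star_sh_at index_sum_simps sum.distrib)
  finally show ?case
    by (simp only: slot_sum_Cons index_sum_Cons slot_sum_sum add.assoc)
qed (simp add: star_lconcat)

text \<open>Multiplying the entry in slot \<open>q\<close> by \<open>y\<close> puts the entry under
  an index \<open>p\<close>, with weight \<open>b $ p\<close>, and \<open>y\<close> under
  \<open>q\<close>. Renaming \<open>q\<close> to \<open>j\<close> and collecting coefficients yields
  \<open>slot_coeff\<close>.\<close>

lemma slot_sum_a_sh_index_sum:
  "slot_sum (\<lambda>u. a_sh b scaleT sh u y) (\<lambda>us. index_sum C us w) us =
    (\<Sum>j\<in>UNIV. index_sum (\<lambda>js. slot_coeff b C js j) us (sh_at sh j w y))"
proof (induction us arbitrary: C w)
  case Nil
  \<comment> \<open>Scaling by \<open>0\<close> gives \<open>incl 0 = 0\<close>.\<close>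
  then show ?case by (simp add: lconcat_def vec_eq_iff incl_simps(3)[of 0, simplified])
next
  case (Cons u us)
  let ?R = "\<lambda>q j. index_sum (\<lambda>js. slot_coeff b (\<lambda>js. C (q # js)) js j) us
    (sh_at sh j (sh_at sh q w u) y)"
  let ?S = "\<lambda>q p. vec_scale scaleT (b $ p)
    (index_sum (\<lambda>js. C (q # js)) us (sh_at sh q (sh_at sh p w u) y))"
  have "slot_sum (\<lambda>u. a_sh b scaleT sh u y) (\<lambda>us. index_sum C us w) (u # us) =
      (\<Sum>q\<in>UNIV. \<Sum>p\<in>UNIV. ?S q p) + (\<Sum>q\<in>UNIV. \<Sum>j\<in>UNIV. ?R q j)"
    by (simp add: slot_sum_sum Cons sh_at_a_sh index_sum_simps)
  also have "\<dots> = (\<Sum>q\<in>UNIV. \<Sum>p\<in>UNIV. ?S q p) + (\<Sum>j\<in>UNIV. \<Sum>q\<in>UNIV. ?R q j)"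
    by (simp only: sum.swap[of ?R])
  also have "\<dots> =
      (\<Sum>j\<in>UNIV. index_sum (\<lambda>js. slot_coeff b C js j) (u # us) (sh_at sh j w y))"
    by (simp add: sh_at_commute[where w = y] index_sum_simps sum.distrib)
  finally show ?case .
qed

text \<open>Here \<open>A f gs\<close> stands for \<open>f\<close> acted on by a product of
  \<open>gs\<close>. In a split of \<open>gs @ [y]\<close>, the entry \<open>y\<close> joins either
  the shuffled entries, where \<open>C_snoc\<close> applies, or the acting ones, where
  \<open>A_snoc\<close> applies.\<close>

lemma iterated_star_lconcat:
  fixes A :: "'t ^ 'n \<Rightarrow> ('t ^ 'n) list \<Rightarrow> 't ^ 'n" and C :: "'n list \<Rightarrow> 'v"
  assumes A_Nil: "\<And>f. A f [] = f"
    and A_snoc: "\<And>f gs y. A f (gs @ [y]) = star (A f gs) y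
      - slot_sum (\<lambda>g. star g y) (A f) gs - slot_sum (\<lambda>g. a_sh b scaleT sh g y) (A f) gs"
    and C_snoc: "\<And>js j. C (js @ [j]) = F j (C js) - slot_coeff b C js j"
  shows "A (lconcat incl (C []) f) gs = split_sum (\<lambda>us ws. index_sum C us (A f ws)) gs"
\<comment> \<open>The recursion replaces entries, so the hypothesis must cover all lists of a given
  length.\<close>
proof (induction "length gs" arbitrary: gs)
  case 0
  then show ?case by (simp add: A_Nil)
next
  case (Suc n)
  then obtain hs y where gs: "gs = hs @ [y]" and n: "length hs = n"
    by (metis length_append_singleton nat.inject length_0_conv nat.distinct(1) rev_exhaust)
  let ?x = "lconcat incl (C []) f" and ?D = "\<lambda>g. star g y" and ?E = "\<lambda>g. a_sh b scaleT sh g y"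
    and ?Q = "\<lambda>us ws. index_sum C us (A f ws)"
  have IH: "A ?x hs' = split_sum ?Q hs'" if "length hs' = length hs" for hs'
    using Suc(1)[of hs'] n that by simp
  have slot: "slot_sum d (A ?x) hs = split_sum (\<lambda>us ws.
      slot_sum d (\<lambda>us. ?Q us ws) us + index_sum C us (slot_sum d (A f) ws)) hs" for d
  proof -
    have "slot_sum d (A ?x) hs = slot_sum d (split_sum ?Q) hs"
      by (rule slot_sum_cong) (rule IH)
    moreover have "slot_sum d (?Q us) ws = index_sum C us (slot_sum d (A f) ws)" for us ws
      by (simp add: slot_sum_def index_sum_simps)
    ultimately show ?thesis by (simp add: slot_sum_split_sum)
  qed
  have diff: "index_sum C us (u - w) = index_sum C us u - index_sum C us w" for us u w
    using index_sum_simps(1)[of C us "u - w" w] by simp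
  have "A ?x gs = star (split_sum ?Q hs) y - slot_sum ?D (A ?x) hs - slot_sum ?E (A ?x) hs"
    by (simp add: gs A_snoc IH)
  also have "\<dots> = split_sum (\<lambda>us ws. star (?Q us ws) y
      - (slot_sum ?D (\<lambda>us. ?Q us ws) us + index_sum C us (slot_sum ?D (A f) ws))
      - (slot_sum ?E (\<lambda>us. ?Q us ws) us + index_sum C us (slot_sum ?E (A f) ws))) hs"
    by (simp add: slot split_sum_diff split_sum_hom[where h = "\<lambda>u. star u y"] star_simps)
  \<comment> \<open>The replacements by \<open>?D\<close> in \<open>us\<close> cancel. Those by
    \<open>?E\<close> turn the coefficients \<open>F j (C js)\<close> into
    \<open>C (js @ [j])\<close>, and the terms on \<open>ws\<close> form
    \<open>A f (ws @ [y])\<close>.\<close>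
  also have "\<dots> = split_sum (\<lambda>us ws. ?Q (us @ [y]) ws + ?Q us (ws @ [y])) hs"
    by (simp add: star_index_sum slot_sum_a_sh_index_sum index_sum_snoc C_snoc A_snoc
        index_sum_simps diff sum_subtractf algebra_simps)
  finally show ?case by (simp add: gs split_sum_snoc split_sum_add)
qed

text \<open>The first entry kills \<open>axis i 1\<close>, and each term of the recursion for a
  longer list contains the value at a shorter nonempty list.\<close>

lemma iterated_star_axis_one:
  fixes A :: "'t ^ 'n \<Rightarrow> ('t ^ 'n) list \<Rightarrow> 't ^ 'n"
  assumes A_Nil: "\<And>f. A f [] = f"
    and A_snoc: "\<And>f gs y. A f (gs @ [y]) = star (A f gs) y
      - slot_sum (\<lambda>g. star g y) (A f) gs - slot_sum (\<lambda>g. a_sh b scaleT sh g y) (A f) gs"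
    and "gs \<noteq> []"
  shows "A (axis i 1) gs = 0"
  using assms(3)
proof (induction "length gs" arbitrary: gs)
  case (Suc n)
  then obtain hs y where gs: "gs = hs @ [y]" by (metis rev_exhaust)
  show ?case
  proof (cases "hs = []")
    case False
    then have "A (axis i 1) hs' = 0" if "length hs' = length hs" for hs'
      using Suc(1)[of hs'] Suc(2) that gs by (cases hs') auto
    then show ?thesis by (simp add: gs A_snoc star_simps slot_sum_def)
  qed (use A_snoc[of _ "[]" y] in \<open>simp add: gs A_Nil star_axis_one\<close>)
qed simp

end

section \<open>Extension to the symmetric algebra\<close>

lemma prod_list_map_nth:
  fixes g :: "'a \<Rightarrow> 's::comm_monoid_mult"
  shows "prod_list (map g gs) = (\<Prod>i<length gs. g (gs ! i))"
  by (induction gs) (simp_all add: prod.lessThan_Suc_shift del: prod.lessThan_Suc)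

lemma prod_list_map_update:
  fixes g :: "'a \<Rightarrow> 's::comm_monoid_mult"
  assumes "m < length gs"
  shows "prod_list (map g (gs[m := z])) = (\<Prod>i\<in>{..<length gs} - {m}. g (gs ! i)) * g z"
proof -
  have "prod_list (map g (gs[m := z])) = (\<Prod>i<length gs. g (gs[m := z] ! i))"
    by (simp only: prod_list_map_nth length_list_update)
  also have "\<dots> = g (gs[m := z] ! m) * (\<Prod>i\<in>{..<length gs} - {m}. g (gs[m := z] ! i))"
    using assms by (intro prod.remove) auto
  also have "(\<Prod>i\<in>{..<length gs} - {m}. g (gs[m := z] ! i)) =
      (\<Prod>i\<in>{..<length gs} - {m}. g (gs ! i))"
    by (intro prod.cong refl arg_cong[where f = g] nth_list_update_neq) blast
  finally show ?thesis
    unfolding nth_list_update_eq[OF assms] by (rule trans[OF _ mult.commute])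
qed

lemma PiE_singleton_image: "({i} \<rightarrow>\<^sub>E B) = (\<lambda>m. \<lambda>_\<in>{i}. m) ` B"
  unfolding PiE_over_singleton_iff by (rule UNION_singleton_eq_range)

lemma sym_product_monomials:
  assumes "is_sym_product scaleS incl op tri"
  shows "tri (prod_list (map incl xs)) (prod_list (map incl ys)) =
    (\<Sum>I\<in>Pow {..<length ys}. \<Sum>\<theta>\<in>{\<theta> \<in> I \<rightarrow>\<^sub>E {..<length xs}. inj_on \<theta> I}.
      (\<Prod>i\<in>{..<length xs} - \<theta> ` I. incl (xs ! i)) *
      (\<Prod>j\<in>{..<length ys} - I. incl (ys ! j)) *
      (\<Prod>i\<in>I. incl (op (xs ! \<theta> i) (ys ! i))))"
  using assms unfolding is_sym_product_def by blast

text \<open>With a single right factor, \<open>I\<close> is empty, giving the commutative product,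
  or \<open>{0}\<close>, and then \<open>\<theta>\<close> chooses the entry contracted with
  \<open>y\<close>.\<close>

lemma sym_product_right_incl:
  assumes "is_sym_product scaleS incl op tri"
  shows "tri (prod_list (map incl gs)) (incl y) =
    prod_list (map incl gs) * incl y
    + slot_sum (\<lambda>g. op g y) (\<lambda>hs. prod_list (map incl hs)) gs"
proof -
  have "inj (\<lambda>m. \<lambda>_\<in>{0::nat}. m :: nat)"
    by (rule injI) (drule fun_cong[of _ _ 0], simp)
  then have inj: "inj_on (\<lambda>m. \<lambda>_\<in>{0::nat}. m) {..<length gs}"
    by (rule inj_on_subset) simp
  have "tri (prod_list (map incl gs)) (incl y) = tri (prod_list (map incl gs)) (prod_list (map incl [y]))"
    by simp
  also have "\<dots> = (\<Prod>i<length gs. incl (gs ! i)) * incl y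
      + (\<Sum>\<theta>\<in>{0::nat} \<rightarrow>\<^sub>E {..<length gs}.
          (\<Prod>i\<in>{..<length gs} - {\<theta> 0}. incl (gs ! i)) * incl (op (gs ! \<theta> 0) y))"
  proof -
    have "Pow {..<length [y]} = {{}, {0}}"
      by (auto simp: lessThan_Suc)
    then show ?thesis
      unfolding sym_product_monomials[OF assms] by (simp add: lessThan_Suc)
  qed
  also have "(\<Sum>\<theta>\<in>{0::nat} \<rightarrow>\<^sub>E {..<length gs}.
        (\<Prod>i\<in>{..<length gs} - {\<theta> 0}. incl (gs ! i)) * incl (op (gs ! \<theta> 0) y)) =
      (\<Sum>m<length gs. (\<Prod>i\<in>{..<length gs} - {m}. incl (gs ! i)) * incl (op (gs ! m) y))"
    unfolding PiE_singleton_image by (subst sum.reindex[OF inj]) simp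
  also have "(\<Prod>i<length gs. incl (gs ! i)) = prod_list (map incl gs)"
    by (simp add: prod_list_map_nth)
  finally show ?thesis
    by (simp add: slot_sum_def prod_list_map_update del: map_update)
qed

text \<open>With a single left factor, injectivity of \<open>\<theta>\<close> leaves only sets
  \<open>I\<close> with at most one element.\<close>

lemma sym_product_left_incl:
  assumes "is_sym_product scaleS incl op tri"
  shows "tri (incl e) (prod_list (map incl gs)) =
    incl e * prod_list (map incl gs)
    + slot_sum (op e) (\<lambda>hs. prod_list (map incl hs)) gs"
proof -
  let ?n = "length gs"
  define G where "G I = (\<Sum>\<theta>\<in>{\<theta> \<in> I \<rightarrow>\<^sub>E {..<1::nat}. inj_on \<theta> I}.
    (\<Prod>i\<in>{..<1} - \<theta> ` I. incl ([e] ! i)) * (\<Prod>j\<in>{..<?n} - I. incl (gs ! j))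
      * (\<Prod>i\<in>I. incl (op ([e] ! \<theta> i) (gs ! i))))" for I
  have G0: "G I = 0" if I: "I \<in> Pow {..<?n} - insert {} ((\<lambda>m. {m}) ` {..<?n})" for I
  proof -
    have False if "\<theta> \<in> I \<rightarrow>\<^sub>E {..<1::nat}" "inj_on \<theta> I" for \<theta>
    proof -
      from I obtain p q where pq: "p \<in> I" "q \<in> I" "p \<noteq> q" by blast
      have "\<theta> p = 0" "\<theta> q = 0"
        using PiE_mem[OF that(1) pq(1)] PiE_mem[OF that(1) pq(2)] by simp_all
      with pq inj_onD[OF that(2), of p q] show False by simp
    qed
    then show ?thesis unfolding G_def by (intro sum.neutral) blast
  qed
  have G1: "G {m} = (\<Prod>i\<in>{..<?n} - {m}. incl (gs ! i)) * incl (op e (gs ! m))" for m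
    by (simp add: G_def PiE_singleton_image lessThan_Suc)
  have "tri (incl e) (prod_list (map incl gs)) =
      tri (prod_list (map incl [e])) (prod_list (map incl gs))"
    by simp
  also have "\<dots> = (\<Sum>I\<in>Pow {..<?n}. G I)"
    unfolding sym_product_monomials[OF assms] G_def
    by (simp only: length_Cons list.size One_nat_def add_0)
  also have "\<dots> = (\<Sum>I\<in>insert {} ((\<lambda>m. {m}) ` {..<?n}). G I)"
    by (rule sum.mono_neutral_right) (use G0 in auto)
  also have "\<dots> = G {} + (\<Sum>m<?n. G {m})"
    by (subst sum.insert) (auto simp: sum.reindex)
  also have "G {} = incl e * prod_list (map incl gs)"
    by (simp add: G_def lessThan_Suc prod_list_map_nth)
  finally show ?thesis
    by (simp add: G1 slot_sum_def prod_list_map_update del: map_update)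
qed

locale shuffle_star_extension = shuffle_star scaleV scaleT incl sh F star +
  S: symmetric_algebra "vec_scale scaleT" scaleS inclS
  for scaleV :: "'k::field \<Rightarrow> 'v::ab_group_add \<Rightarrow> 'v"
    and scaleT :: "'k \<Rightarrow> 't::ring_1 \<Rightarrow> 't" and incl :: "'v \<Rightarrow> 't"
    and sh :: "'t \<Rightarrow> 't \<Rightarrow> 't" and F :: "'n::finite \<Rightarrow> 'v \<Rightarrow> 'v"
    and star :: "'t ^ 'n \<Rightarrow> 't ^ 'n \<Rightarrow> 't ^ 'n"
    and scaleS :: "'k \<Rightarrow> 's::comm_ring_1 \<Rightarrow> 's" and inclS :: "'t ^ 'n \<Rightarrow> 's" +
  fixes a :: "'k ^ 'n" and tri :: "'s \<Rightarrow> 's \<Rightarrow> 's" and counit :: "'s \<Rightarrow> 'k"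
    and starS :: "'s \<Rightarrow> 's \<Rightarrow> 's"
  assumes sym_product: "is_sym_product scaleS inclS (a_sh a scaleT sh) tri"
    and counit: "is_counit scaleS inclS counit"
    and extension: "is_star_extension scaleS inclS tri counit star starS"
begin

lemma tri_bilinear: "bilinear_map scaleS scaleS scaleS tri"
  using sym_product by (simp add: is_sym_product_def)

lemma starS_bilinear: "bilinear_map scaleS scaleS scaleS starS"
  using extension by (simp add: is_star_extension_def)

lemmas tri_simps = bilinear_mapD[OF tri_bilinear]
lemmas starS_simps = bilinear_mapD[OF starS_bilinear]
lemmas inclS_hom = Vector_Spaces.linear.axioms(3)[OF S.linear_incl]
lemmas inclS_simps = module_hom.add[OF inclS_hom] module_hom.diff[OF inclS_hom]
  module_hom.zero[OF inclS_hom] module_hom.sum[OF inclS_hom]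

lemma starS_incl: "starS (inclS u) (inclS v) = inclS (star u v)"
  and starS_one_right: "starS G 1 = G"
  and starS_tri_right: "starS G (tri H (inclS y)) =
    starS (starS G H) (inclS y) - starS G (starS H (inclS y))"
  using extension by (simp_all add: is_star_extension_def)

lemma starS_one_incl: "starS 1 (inclS y) = 0"
  using extension counit by (simp add: is_star_extension_def is_counit_def)

text \<open>The generator \<open>inclS y\<close> is primitive, and \<open>1\<close> acts as the
  identity from the right.\<close>

lemma starS_tri_incl:
  "starS (tri G H) (inclS y) = tri (starS G (inclS y)) H + tri G (starS H (inclS y))"
proof -
  have "starS (tri G H) (inclS y) =
      (\<Sum>(k1, k2)\<leftarrow>[(inclS y, 1), (1, inclS y)]. tri (starS G k1) (starS H k2))"
    using extension unfolding is_star_extension_def by (blast intro: sweedler.prim)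
  then show ?thesis by (simp add: starS_one_right)
qed

lemma tri_list_snoc: "tri_list tri inclS (gs @ [g]) = tri (tri_list tri inclS gs) (inclS g)"
  by (simp add: tri_list_def)

lemma starS_tri_list:
  "starS (tri_list tri inclS gs) (inclS y) =
    slot_sum (\<lambda>g. star g y) (tri_list tri inclS) gs"
proof (induction gs rule: rev_induct)
  case Nil
  then show ?case by (simp add: tri_list_def starS_one_incl)
next
  case (snoc g gs)
  then show ?case
    by (simp add: tri_list_snoc starS_tri_incl slot_sum_snoc starS_incl)
      (simp add: slot_sum_def tri_simps)
qed

text \<open>Multilinearity. Since \<open>a_sh\<close> with weight \<open>0\<close> vanishes, this
  brings the \<open>tri\<close> recursion into the form shared by both products.\<close>

lemma slot_sum_zero_tri_list: "slot_sum (\<lambda>_. 0) (tri_list tri inclS) gs = 0"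
proof (induction gs rule: rev_induct)
  case (snoc g gs)
  have "slot_sum (\<lambda>_. 0) (\<lambda>hs. tri (tri_list tri inclS hs) (inclS g)) gs =
      tri (slot_sum (\<lambda>_. 0) (tri_list tri inclS) gs) (inclS g)"
    by (simp add: slot_sum_def tri_simps)
  with snoc show ?case
    by (simp add: tri_list_snoc slot_sum_snoc inclS_simps tri_simps)
qed simp

text \<open>The derivation rule is given for \<open>tri\<close>. Passing to the commutative product
  costs the contractions with the last factor \<open>h\<close>; acting by \<open>y\<close> commutes
  with these up to contractions with \<open>star h y\<close>.\<close>

lemma starS_prod_list:
  "starS (prod_list (map inclS gs)) (inclS y) =
    slot_sum (\<lambda>g. star g y) (\<lambda>hs. prod_list (map inclS hs)) gs"
proof (induction "length gs" arbitrary: gs)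
  case 0
  then show ?case by (simp add: starS_one_incl)
next
  case (Suc n)
  then obtain hs h where gs: "gs = hs @ [h]" by (metis list.size(3) nat.distinct(1) rev_exhaust)
  let ?P = "\<lambda>hs. prod_list (map inclS hs)" and ?D = "\<lambda>g. star g y"
    and ?E = "\<lambda>h g. a_sh a scaleT sh g h"
  have IH: "starS (?P hs') (inclS y) = slot_sum ?D ?P hs'" if "length hs' = length hs" for hs'
    using Suc that gs by simp
  note tri = sym_product_right_incl[OF sym_product]
  have comm: "slot_sum (?E h) (slot_sum ?D ?P) hs =
      slot_sum ?D (slot_sum (?E h) ?P) hs + slot_sum (?E (star h y)) ?P hs"
    by (rule slot_sum_commute) (simp add: star_a_sh inclS_simps distrib_left distrib_right)
  have "?P gs = tri (?P hs) (inclS h) - slot_sum (?E h) ?P hs"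
    by (simp add: gs tri)
  then have "starS (?P gs) (inclS y) =
      starS (tri (?P hs) (inclS h)) (inclS y) - starS (slot_sum (?E h) ?P hs) (inclS y)"
    by (simp only: starS_simps)
  also have "starS (slot_sum (?E h) ?P hs) (inclS y) = slot_sum (?E h) (slot_sum ?D ?P) hs"
    by (simp add: slot_sum_def[of "?E h"] starS_simps IH del: map_update)
  also have "starS (tri (?P hs) (inclS h)) (inclS y) =
      tri (slot_sum ?D ?P hs) (inclS h) + tri (?P hs) (inclS (star h y))"
    by (simp add: starS_tri_incl IH starS_incl)
  also have "tri (slot_sum ?D ?P hs) (inclS h) =
      slot_sum ?D (\<lambda>hs. ?P hs * inclS h + slot_sum (?E h) ?P hs) hs"
    unfolding tri[symmetric] by (simp add: slot_sum_def[of ?D] tri_simps)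
  finally show ?case
    by (simp add: comm slot_sum_add tri gs slot_sum_snoc)
qed

text \<open>The rule for \<open>starS\<close> on \<open>tri H (inclS y)\<close> turns the recursion
  for \<open>P\<close> into the one required of \<open>A\<close>. It also keeps the values in the
  image of \<open>inclS\<close>, where the inverse in \<open>star_act\<close> is meaningful.\<close>

lemma star_act_recursion:
  assumes P_Nil: "P [] = 1"
    and P_snoc: "\<And>gs y. P (gs @ [y]) =
      tri (P gs) (inclS y) - slot_sum (\<lambda>g. a_sh b scaleT sh g y) P gs"
    and P_star: "\<And>gs y. starS (P gs) (inclS y) = slot_sum (\<lambda>g. star g y) P gs"
  shows "inclS (star_act inclS starS f (P gs)) = starS (inclS f) (P gs)"
    and "star_act inclS starS f (P []) = f"
    and "star_act inclS starS f (P (gs @ [y])) = star (star_act inclS starS f (P gs)) y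
      - slot_sum (\<lambda>g. star g y) (\<lambda>hs. star_act inclS starS f (P hs)) gs
      - slot_sum (\<lambda>g. a_sh b scaleT sh g y) (\<lambda>hs. star_act inclS starS f (P hs)) gs"
proof -
  have inv: "star_act inclS starS f G = u" if "starS (inclS f) G = inclS u" for u G
    using that S.inj_incl by (simp add: star_act_def the_inv_f_f)
  have snoc: "starS (inclS f) (P (gs @ [y])) = inclS (star (star_act inclS starS f (P gs)) y
      - slot_sum (\<lambda>g. star g y) (\<lambda>hs. star_act inclS starS f (P hs)) gs
      - slot_sum (\<lambda>g. a_sh b scaleT sh g y) (\<lambda>hs. star_act inclS starS f (P hs)) gs)"
    if "\<And>hs. length hs = length gs \<Longrightarrow>
      starS (inclS f) (P hs) = inclS (star_act inclS starS f (P hs))" for gs y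
    by (simp add: P_snoc starS_simps starS_tri_right P_star slot_sum_def that starS_incl inclS_simps)
  have incl: "starS (inclS f) (P gs) = inclS (star_act inclS starS f (P gs))" for gs
  proof (induction "length gs" arbitrary: gs)
    case 0
    then show ?case by (simp add: P_Nil starS_one_right inv)
  next
    case (Suc n)
    then obtain hs h where gs: "gs = hs @ [h]" by (metis list.size(3) nat.distinct(1) rev_exhaust)
    have "\<exists>u. starS (inclS f) (P gs) = inclS u"
      unfolding gs by (rule exI, rule snoc) (use Suc gs in simp)
    then show ?case using inv by auto
  qed
  show "inclS (star_act inclS starS f (P gs)) = starS (inclS f) (P gs)"
    by (simp add: incl)
  show "star_act inclS starS f (P []) = f"
    by (rule inv) (simp add: P_Nil starS_one_right)
  show "star_act inclS starS f (P (gs @ [y])) = star (star_act inclS starS f (P gs)) y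
      - slot_sum (\<lambda>g. star g y) (\<lambda>hs. star_act inclS starS f (P hs)) gs
      - slot_sum (\<lambda>g. a_sh b scaleT sh g y) (\<lambda>hs. star_act inclS starS f (P hs)) gs"
    by (rule inv) (rule snoc, rule incl)
qed

text \<open>Common to both products: \<open>P\<close> is the product, \<open>b\<close> its
  contraction weight and \<open>C\<close> the matching coefficients.\<close>

lemma starS_expansion:
  assumes "P [] = 1"
    and "\<And>gs y. P (gs @ [y]) =
      tri (P gs) (inclS y) - slot_sum (\<lambda>g. a_sh b scaleT sh g y) P gs"
    and "\<And>gs y. starS (P gs) (inclS y) = slot_sum (\<lambda>g. star g y) P gs"
    and C_snoc: "\<And>js j. C (js @ [j]) = F j (C js) - slot_coeff b C js j"
    and "gs \<noteq> []"
  shows "starS (inclS (axis i 1)) (P gs) = 0"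
    and "starS (inclS (lconcat incl (C []) f)) (P gs) =
      inclS (\<Sum>I\<in>Pow {..<length gs}. \<Sum>js\<in>{js. length js = card I}.
        lconcat incl (C js)
          (sh_iter sh (star_act inclS starS f (P (nths gs (- I)))) js (nths gs I)))"
proof -
  note A = star_act_recursion[OF assms(1-3)]
  show "starS (inclS (axis i 1)) (P gs) = 0"
    using iterated_star_axis_one[where A = "\<lambda>f gs. star_act inclS starS f (P gs)", OF A(2,3) assms(5)]
    by (simp add: inclS_simps flip: A(1))
  have card: "card I = length (nths gs I)" if "I \<in> Pow {..<length gs}" for I
    using that by (auto simp: length_nths intro!: arg_cong[where f = card])
  have "(\<Sum>I\<in>Pow {..<length gs}. \<Sum>js\<in>{js. length js = card I}.
        lconcat incl (C js)
          (sh_iter sh (star_act inclS starS f (P (nths gs (- I)))) js (nths gs I))) =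
      (\<Sum>I\<in>Pow {..<length gs}. index_sum C (nths gs I) (star_act inclS starS f (P (nths gs (- I)))))"
    unfolding index_sum_def by (rule sum.cong) (simp_all only: card)
  also have "\<dots> = star_act inclS starS (lconcat incl (C []) f) (P gs)"
    unfolding split_sum_nths[where Q = "\<lambda>us ws. index_sum C us (star_act inclS starS f (P ws))"]
    by (rule iterated_star_lconcat[where A = "\<lambda>f gs. star_act inclS starS f (P gs)",
          OF A(2,3) C_snoc, symmetric])
  finally show "starS (inclS (lconcat incl (C []) f)) (P gs) =
      inclS (\<Sum>I\<in>Pow {..<length gs}. \<Sum>js\<in>{js. length js = card I}.
        lconcat incl (C js)
          (sh_iter sh (star_act inclS starS f (P (nths gs (- I)))) js (nths gs I)))"
    by (simp add: A(1))
qed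

end

section \<open>Coefficients given by the action morphism\<close>

lemma ga_product_axis: "ga_product a (axis i 1) (axis j 1) = a $ j *s axis i 1"
  for a :: "'k::field ^ 'n::finite"
proof -
  have "ga_product a (axis i 1) (axis j 1) =
      (\<Sum>p\<in>UNIV. \<Sum>q\<in>UNIV. if p = i then (if q = j then a $ j *s axis i 1 else 0) else 0)"
    unfolding ga_product_def by (intro sum.cong) (auto simp: axis_def vec_eq_iff)
  then show ?thesis by (simp add: sum.If_cases)
qed

text \<open>The morphism \<open>\<phi>\<close> turns left \<open>triU\<close> multiplication by
  \<open>\<epsilon>\<^sub>j\<close> into \<open>F j\<close>. That product is the commutative one
  plus contractions, each turning an index \<open>p\<close> into \<open>j\<close> with weight
  \<open>a $ p\<close>.\<close>

lemma action_morphism_snoc: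
  fixes a :: "'k::field ^ 'n::finite" and scaleU :: "'k \<Rightarrow> 'u::comm_ring_1 \<Rightarrow> 'u"
  assumes "symmetric_algebra (*s) scaleU inclU"
    and sym: "is_sym_product scaleU inclU (ga_product a) triU"
    and morph: "is_action_morphism scaleV F scaleU inclU triU \<phi>"
  fixes x defines "C \<equiv> \<lambda>js. \<phi> (prod_list (map (\<lambda>j. inclU (axis j 1)) js)) x"
  shows "C (js @ [j]) =
    F j (C js) - (\<Sum>m<length js. scaleV (a $ (js ! m)) (C (js[m := j])))"
proof -
  interpret U: symmetric_algebra "(*s)" scaleU inclU by fact
  interpret incl: Vector_Spaces.linear "(*s)" scaleU inclU by (rule U.linear_incl)
  let ?e = "\<lambda>j. axis j 1 :: 'k ^ 'n" and ?P = "\<lambda>gs. prod_list (map inclU gs)"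
  have bil: "bilinear_map scaleU scaleV scaleV \<phi>"
    using morph by (simp add: is_action_morphism_def)
  have C: "C js = \<phi> (?P (map ?e js)) x" for js
    by (simp add: C_def comp_def)
  have "?P ((map ?e js)[m := ga_product a (?e j) (map ?e js ! m)]) =
      scaleU (a $ (js ! m)) (?P (map ?e (js[m := j])))" if "m < length js" for m
    using that unfolding map_update[of ?e]
    by (simp add: prod_list_map_update ga_product_axis incl.scale U.scale_mult_right
        del: map_update map_map)
  then have "triU (inclU (?e j)) (?P (map ?e js)) = inclU (?e j) * ?P (map ?e js)
      + (\<Sum>m<length js. scaleU (a $ (js ! m)) (?P (map ?e (js[m := j]))))"
    by (simp add: sym_product_left_incl[OF sym] slot_sum_def del: map_update map_map)
  moreover have "\<phi> (triU (inclU (?e j)) (?P (map ?e js))) x = F j (C js)"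
    using morph by (simp add: is_action_morphism_def C)
  ultimately have "F j (C js) = \<phi> (inclU (?e j) * ?P (map ?e js)) x
      + (\<Sum>m<length js. scaleV (a $ (js ! m)) (C (js[m := j])))"
    by (simp add: bilinear_mapD[OF bil] C del: map_update map_map)
  \<comment> \<open>Commutativity moves the index \<open>j\<close> from the front to the
    end.\<close>
  then show ?thesis by (simp add: C mult.commute)
qed

theorem proposition15:
  fixes scaleV :: "'k::field \<Rightarrow> 'v::ab_group_add \<Rightarrow> 'v"
    and a :: "'k ^ 'n::finite"
    and F :: "'n \<Rightarrow> 'v \<Rightarrow> 'v"
    and scaleT :: "'k \<Rightarrow> 't::ring_1 \<Rightarrow> 't" and inclT :: "'v \<Rightarrow> 't"
    and sh :: "'t \<Rightarrow> 't \<Rightarrow> 't"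
    and star :: "'t ^ 'n \<Rightarrow> 't ^ 'n \<Rightarrow> 't ^ 'n"
    and scaleS :: "'k \<Rightarrow> 's::comm_ring_1 \<Rightarrow> 's" and inclS :: "'t ^ 'n \<Rightarrow> 's"
    and tri :: "'s \<Rightarrow> 's \<Rightarrow> 's" and counit :: "'s \<Rightarrow> 'k" and starS :: "'s \<Rightarrow> 's \<Rightarrow> 's"
    and scaleU :: "'k \<Rightarrow> 'u::comm_ring_1 \<Rightarrow> 'u" and inclU :: "'k ^ 'n \<Rightarrow> 'u"
    and triU :: "'u \<Rightarrow> 'u \<Rightarrow> 'u" and \<phi> :: "'u \<Rightarrow> 'v \<Rightarrow> 'v"
    and x :: 'v and f :: "'t ^ 'n" and gs :: "('t ^ 'n) list" and i :: 'n
  assumes "vector_space scaleV"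
    and "is_ga_module a scaleV F"
    and "tensor_algebra scaleV scaleT inclT"
    and "is_shuffle scaleT inclT sh"
    and "is_star scaleT inclT sh F star"
    and "symmetric_algebra (vec_scale scaleT) scaleS inclS"
    and "is_sym_product scaleS inclS (a_sh a scaleT sh) tri"
    and "is_counit scaleS inclS counit"
    and "is_star_extension scaleS inclS tri counit star starS"
    and "symmetric_algebra (*s) scaleU inclU"
    and "is_sym_product scaleU inclU (ga_product a) triU"
    and "is_action_morphism scaleV F scaleU inclU triU \<phi>"
    and "length gs \<ge> 1"
  shows "(starS (inclS (axis i 1)) (tri_list tri inclS gs) = 0) \<and>
    (starS (inclS (lconcat inclT x f)) (tri_list tri inclS gs) =
      inclS (\<Sum>I\<in>Pow {..<length gs}. \<Sum>js\<in>{js. length js = card I}.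
        lconcat inclT (fold F js x)
          (sh_iter sh (star_act inclS starS f (tri_list tri inclS (nths gs (- I))))
            js (nths gs I)))) \<and>
    (starS (inclS (axis i 1)) (prod_list (map inclS gs)) = 0) \<and>
    (starS (inclS (lconcat inclT x f)) (prod_list (map inclS gs)) =
      inclS (\<Sum>I\<in>Pow {..<length gs}. \<Sum>js\<in>{js. length js = card I}.
        lconcat inclT (\<phi> (prod_list (map (\<lambda>j. inclU (axis j 1)) js)) x)
          (sh_iter sh (star_act inclS starS f (prod_list (map inclS (nths gs (- I)))))
            js (nths gs I))))"
proof -
  interpret shuffle_star_extension scaleV scaleT inclT sh F star scaleS inclS a tri counit starS
    using assms by (intro shuffle_star_extension.intro shuffle_star.intro
        shuffle_star_axioms.intro shuffle_star_extension_axioms.intro)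
  have gs: "gs \<noteq> []"
    using assms by auto
  \<comment> \<open>The weight for \<open>tri\<close> is \<open>0\<close>, so the coefficients are
    plain composites; \<open>fold\<close> applies the first index first.\<close>
  have fold_snoc: "fold F (js @ [j]) x = F j (fold F js x) - slot_coeff 0 (\<lambda>js. fold F js x) js j"
    for js j
    by (simp add: slot_coeff_def)
  have "a_sh 0 scaleT sh g y = 0" for g y :: "'t ^ 'n"
    by (simp add: vec_eq_iff a_sh_nth)
  then have tri_snoc: "tri_list tri inclS (gs @ [y]) = tri (tri_list tri inclS gs) (inclS y)
      - slot_sum (\<lambda>g. a_sh 0 scaleT sh g y) (tri_list tri inclS) gs" for gs y
    by (simp add: tri_list_snoc slot_sum_zero_tri_list)
  have tri_Nil: "tri_list tri inclS [] = 1"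
    by (simp add: tri_list_def)
  note tri_expansion = starS_expansion[where P = "tri_list tri inclS",
      OF tri_Nil tri_snoc starS_tri_list fold_snoc gs]
  let ?P = "\<lambda>gs. prod_list (map inclS gs)"
    and ?C = "\<lambda>js. \<phi> (prod_list (map (\<lambda>j. inclU (axis j 1)) js)) x"
  have prod_snoc: "?P (gs @ [y]) =
      tri (?P gs) (inclS y) - slot_sum (\<lambda>g. a_sh a scaleT sh g y) ?P gs" for gs y
    by (simp add: sym_product_right_incl[OF sym_product])
  have C_snoc: "?C (js @ [j]) = F j (?C js) - slot_coeff a ?C js j" for js j
    unfolding slot_coeff_def by (rule action_morphism_snoc[OF assms(10-12)])
  have prod_Nil: "?P [] = 1"
    by simp
  note prod_expansion = starS_expansion[where P = ?P and C = ?C,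
      OF prod_Nil prod_snoc starS_prod_list C_snoc gs]
  \<comment> \<open>The empty monomial is \<open>1\<close>, which acts as the identity, so the
    leading letter is \<open>x\<close>.\<close>
  have C_Nil: "?C [] = x"
    using assms(12) by (simp add: is_action_morphism_def)
  show ?thesis
    using tri_expansion(1) tri_expansion(2)[unfolded fold_Nil id_apply]
      prod_expansion(1) prod_expansion(2)[unfolded C_Nil]
    by (intro conjI)
qed

end
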